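(* Let $(X,\mathcal S(X),\mu,T)$ be a conservative and ergodic nonsingular dynamical system. Then either $T$ is W-measurably sensitive, or $T$ is isomorphic mod $0$ to an invertible minimal uniformly rigid isometry on a Polish space.
   Context: A nonsingular dynamical system is a quadruple $(X,\mathcal S(X),\mu,T)$ (also written $(X,\mu,T)$) where $(X,\mathcal S(X))$ is a standard Borel space, $\mu$ is a nonzero $\sigma$-finite nonatomic measure on $\mathcal S(X)$, and $T:X\to X$ is measurable with $\mu(A)=0$ if and only if $\mu(T^{-1}(A))=0$ for all $A\in\mathcal S(X)$. $T$ is conservative and ergodic if and only if for every measurable $A$ with $T^{-1}(A)\subset A$ one has $\mu(A)=0$ or $\mu(A^c)=0$. All metrics $d:X\times X\to\mathbb R$ put on $X$ are assumed Borel measurable and bounded by $1$. Such a metric $d$ is $\mu$-compatible if every ball $\{y: d(x,y)<\varepsilon\}$ ($x\in X$, $\varepsilon>0$) has positive $\mu$-measure. For a $\mu$-compatible metric $d$, the system is W-measurably sensitive with respect to $d$ if there is $\delta>0$ such that for every $x\in X$, $\limsup_{n\to\infty} d(T^nx,T^ny)>\delta$ for $\mu$-almost every $y\in X$. The system is W-measurably sensitive if this holds for every $\mu$-compatible metric $d$ on $X$ ($\delta$ may depend on $d$). Isomorphism mod $0$ of $(X,\mu,T)$ and $(X',\mu',T')$: there are Borel sets $U\subset X$, $U'\subset X'$ with $\mu(X\setminus U)=\mu'(X'\setminus U')=0$, $T(U)\subset U$, $T'(U')\subset U'$, and a measure-preserving (bimeasurable) bijection $\phi:U\to U'$ with $\phi\circ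 T=T'\circ\phi$ on $U$. For a metric space $(Y,\rho)$ and $S:Y\to Y$, let $\omega(y)$ be the set of accumulation points of $\{S^ny:n\ge 0\}$. $S$ is minimal if $\omega(y)=Y$ for all $y\in Y$; $S$ is uniformly rigid if there is a sequence $n_i\to\infty$ with $\rho(S^{n_i}y,y)\to 0$ uniformly in $y\in Y$. "Isomorphic mod $0$ to an invertible minimal uniformly rigid isometry on a Polish space" means: there are a complete separable metric space $(Y,\rho)$, a bijective isometry $S:Y\to Y$ that is minimal and uniformly rigid for $\rho$, and a Borel measure $\nu$ on $Y$ such that $(Y,\nu,S)$ is a nonsingular dynamical system isomorphic mod $0$ to $(X,\mu,T)$. *)

theory Defs
  imports "HOL-Analysis.Analysis"
begin

definition borel_sets_of :: "'a topology \<Rightarrow> 'a set set" where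
  "borel_sets_of X = sigma_sets (topspace X) {U. openin X U}"

definition standard_borel :: "'a measure \<Rightarrow> bool" where
  "standard_borel M \<longleftrightarrow>
     (\<exists>X. completely_metrizable_space X \<and> separable_space X \<and>
          topspace X = space M \<and> sets M = borel_sets_of X)"

definition nonatomic :: "'a measure \<Rightarrow> bool" where
  "nonatomic M \<longleftrightarrow>
     (\<forall>A\<in>sets M. emeasure M A > 0 \<longrightarrow>
        (\<exists>B\<in>sets M. B \<subseteq> A \<and> 0 < emeasure M B \<and> emeasure M B < emeasure M A))"

locale nonsingular_system = sigma_finite_measure M
  for M :: "'a measure" and T :: "'a \<Rightarrow> 'a" +
  assumes standard_borel: "standard_borel M"
    and nonzero: "emeasure M (space M) \<noteq> 0"
    and nonatomic: "nonatomic M"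
    and measurable_map: "T \<in> measurable M M"
    and nonsingular:
      "\<And>A. A \<in> sets M \<Longrightarrow> emeasure M A = 0 \<longleftrightarrow> emeasure M (T -` A \<inter> space M) = 0"

definition conservative_ergodic :: "'a measure \<Rightarrow> ('a \<Rightarrow> 'a) \<Rightarrow> bool" where
  "conservative_ergodic M T \<longleftrightarrow>
     (\<forall>A\<in>sets M. T -` A \<inter> space M \<subseteq> A \<longrightarrow>
        emeasure M A = 0 \<or> emeasure M (space M - A) = 0)"

text \<open>
  The \<open>Metric_space\<close> locale also asks for symmetry and nonnegativity off the carrier. This is
  harmless: any metric on \<open>space M\<close> can be extended by \<open>0\<close>, and nothing below depends on the
  values off the carrier.
\<close>

definition compatible_metric :: "'a measure \<Rightarrow> ('a \<Rightarrow> 'a \<Rightarrow> real) \<Rightarrow> bool" where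
  "compatible_metric M d \<longleftrightarrow>
     Metric_space (space M) d \<and>
     (\<lambda>(x, y). d x y) \<in> borel_measurable (M \<Otimes>\<^sub>M M) \<and>
     (\<forall>x\<in>space M. \<forall>y\<in>space M. d x y \<le> 1) \<and>
     (\<forall>x\<in>space M. \<forall>\<epsilon>>0. emeasure M (Metric_space.mball (space M) d x \<epsilon>) > 0)"

definition W_measurably_sensitive_wrt ::
    "'a measure \<Rightarrow> ('a \<Rightarrow> 'a) \<Rightarrow> ('a \<Rightarrow> 'a \<Rightarrow> real) \<Rightarrow> bool" where
  "W_measurably_sensitive_wrt M T d \<longleftrightarrow>
     (\<exists>\<delta>::real. \<delta> > 0 \<and>
        (\<forall>x\<in>space M. AE y in M.
           limsup (\<lambda>n. ereal (d ((T ^^ n) x) ((T ^^ n) y))) > ereal \<delta>))"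

definition W_measurably_sensitive :: "'a measure \<Rightarrow> ('a \<Rightarrow> 'a) \<Rightarrow> bool" where
  "W_measurably_sensitive M T \<longleftrightarrow>
     (\<forall>d. compatible_metric M d \<longrightarrow> W_measurably_sensitive_wrt M T d)"

definition isomorphic_mod0 ::
    "'a measure \<Rightarrow> ('a \<Rightarrow> 'a) \<Rightarrow> 'b measure \<Rightarrow> ('b \<Rightarrow> 'b) \<Rightarrow> bool" where
  "isomorphic_mod0 M T M' T' \<longleftrightarrow>
     (\<exists>U\<in>sets M. \<exists>U'\<in>sets M'. \<exists>\<phi>.
        emeasure M (space M - U) = 0 \<and> emeasure M' (space M' - U') = 0 \<and>
        T ` U \<subseteq> U \<and> T' ` U' \<subseteq> U' \<and>
        bij_betw \<phi> U U' \<and>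
        \<phi> \<in> measurable (restrict_space M U) (restrict_space M' U') \<and>
        the_inv_into U \<phi> \<in> measurable (restrict_space M' U') (restrict_space M U) \<and>
        (\<forall>B\<in>sets M'. B \<subseteq> U' \<longrightarrow> emeasure M (\<phi> -` B \<inter> U) = emeasure M' B) \<and>
        (\<forall>x\<in>U. \<phi> (T x) = T' (\<phi> x)))"

definition omega_limit :: "'b set \<Rightarrow> ('b \<Rightarrow> 'b \<Rightarrow> real) \<Rightarrow> ('b \<Rightarrow> 'b) \<Rightarrow> 'b \<Rightarrow> 'b set" where
  "omega_limit Y \<rho> S y = Metric_space.mtopology Y \<rho> derived_set_of {(S ^^ n) y | n. True}"

definition minimal_map :: "'b set \<Rightarrow> ('b \<Rightarrow> 'b \<Rightarrow> real) \<Rightarrow> ('b \<Rightarrow> 'b) \<Rightarrow> bool" where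
  "minimal_map Y \<rho> S \<longleftrightarrow> (\<forall>y\<in>Y. omega_limit Y \<rho> S y = Y)"

definition uniformly_rigid :: "'b set \<Rightarrow> ('b \<Rightarrow> 'b \<Rightarrow> real) \<Rightarrow> ('b \<Rightarrow> 'b) \<Rightarrow> bool" where
  "uniformly_rigid Y \<rho> S \<longleftrightarrow>
     (\<exists>n :: nat \<Rightarrow> nat. filterlim n at_top sequentially \<and>
        uniform_limit Y (\<lambda>i y. \<rho> ((S ^^ n i) y) y) (\<lambda>_. 0) sequentially)"

definition bijective_isometry :: "'b set \<Rightarrow> ('b \<Rightarrow> 'b \<Rightarrow> real) \<Rightarrow> ('b \<Rightarrow> 'b) \<Rightarrow> bool" where
  "bijective_isometry Y \<rho> S \<longleftrightarrow>
     bij_betw S Y Y \<and> (\<forall>x\<in>Y. \<forall>y\<in>Y. \<rho> (S x) (S y) = \<rho> x y)"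

definition polish_isometry_system ::
    "'b set \<Rightarrow> ('b \<Rightarrow> 'b \<Rightarrow> real) \<Rightarrow> ('b \<Rightarrow> 'b) \<Rightarrow> 'b measure \<Rightarrow> bool" where
  "polish_isometry_system Y \<rho> S N \<longleftrightarrow>
     Metric_space Y \<rho> \<and> Metric_space.mcomplete Y \<rho> \<and>
     separable_space (Metric_space.mtopology Y \<rho>) \<and>
     bijective_isometry Y \<rho> S \<and> minimal_map Y \<rho> S \<and> uniformly_rigid Y \<rho> S \<and>
     space N = Y \<and> sets N = borel_sets_of (Metric_space.mtopology Y \<rho>) \<and>
     nonsingular_system N S"

text \<open>
  HOL cannot quantify existentially over the type carrying the Polish space. Taking arbitrary
  subsets of \<^typ>\<open>nat \<Rightarrow> real\<close> with arbitrary metrics (unrelated to any structure of that type)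
  loses nothing: if \<open>q\<close> is a dense sequence in a separable metric space \<open>(Y, \<rho>)\<close>, then
  \<open>y \<mapsto> (\<lambda>k. \<rho> y (q k))\<close> is injective, so the metric, the map and the measure can be transported
  along it.
\<close>

definition isomorphic_to_polish_isometry :: "'a measure \<Rightarrow> ('a \<Rightarrow> 'a) \<Rightarrow> bool" where
  "isomorphic_to_polish_isometry M T \<longleftrightarrow>
     (\<exists>(Y :: (nat \<Rightarrow> real) set) \<rho> S N.
        polish_isometry_system Y \<rho> S N \<and> isomorphic_mod0 M T N S)"

end

theory Submission
  imports Defs
begin

text \<open>
  Suppose that \<open>T\<close> is insensitive for some compatible metric \<open>d\<close>, and replace \<open>d\<close> by
  \<open>d\<^sub>T(x, y) = sup\<^sub>n d(T\<^sup>n x, T\<^sup>n y)\<close>, for which \<open>T\<close> is 1-Lipschitz. Insensitivity gives, for each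
  radius, a set of positive measure whose points have \<open>d\<^sub>T\<close>-balls of positive measure; the set of
  all such points is forward invariant, hence conull. On the conull intersection \<open>F\<close> over all radii, ergodicity
  and Fubini provide a point whose orbit is dense and recurrent. A 1-Lipschitz map
  with such an orbit is a uniformly rigid isometry, so \<open>T\<close> extends to a minimal isometry of the
  completion of \<open>F\<close>. By inner regularity, the inclusion of \<open>F\<close> into its completion is bimeasurable
  on a conull countable union of compact sets, hence on a conull forward invariant set.
\<close>

subsection \<open>Inner regularity and injective Borel images\<close>

text \<open>The metric \<open>d\<close> is only Borel measurable: its topology need not be the one
  that makes \<open>M\<close> standard Borel, and the core need not be complete. That its image in
  the completion is Borel would be a case of the Lusin-Souslin theorem; compactness arguments give
  enough of this up to null sets, and an isomorphism mod 0 asks for no more. Insensitivity yields,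
  for each threshold, a single point x and a nonnull set of y whose orbits are eventually close to
  that of x. The time N from which they stay close takes countably many values, so one N may be
  fixed, and T^N moves the points y belonging to it into a small ball of the orbit metric. This
  passage from a limsup to a supremum is what the orbit metric is made for. \<open>T\<close> need
  not map the core onto itself. Recurrence makes the image dense, and an isometry with dense image
  becomes onto after completion.\<close>

lemma openin_borel_sets_of: "openin X U \<Longrightarrow> U \<in> borel_sets_of X"
  by (simp add: borel_sets_of_def sigma_sets.Basic)

lemma sigma_algebra_borel_sets_of: "sigma_algebra (topspace X) (borel_sets_of X)"
  unfolding borel_sets_of_def
  by (rule sigma_algebra_sigma_sets) (auto dest: openin_subset)

lemma closedin_borel_sets_of:
  assumes "closedin X C"
  shows "C \<in> borel_sets_of X"
proof -
  interpret sigma_algebra "topspace X" "borel_sets_of X"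
    by (rule sigma_algebra_borel_sets_of)
  have "topspace X - (topspace X - C) \<in> borel_sets_of X"
    using assms by (intro compl_sets openin_borel_sets_of) auto
  then show ?thesis
    using closedin_subset[OF assms] by (simp add: double_diff)
qed

context finite_measure
begin

lemma measure_UN_le_geometric:
  assumes "\<And>n. A n \<in> sets M" "\<And>n. measure M (A n) \<le> e * (1/2) ^ Suc n"
  shows "measure M (\<Union>n. A n) \<le> e"
proof -
  have s: "(\<lambda>n. e * (1/2) ^ Suc n) sums (e * 1)"
    by (intro sums_mult power_half_series)
  have sm: "summable (\<lambda>n. measure M (A n))"
    by (rule summable_comparison_test'[OF sums_summable[OF s]]) (use assms in auto)
  have "measure M (\<Union>n. A n) \<le> (\<Sum>n. measure M (A n))"
    using assms sm by (intro finite_measure_subadditive_countably) auto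
  also have "\<dots> \<le> (\<Sum>n. e * (1/2) ^ Suc n)"
    using assms by (intro suminf_le sm sums_summable[OF s]) auto
  also have "\<dots> = e"
    using sums_unique[OF s] by simp
  finally show ?thesis .
qed

text \<open>Continuity from above. It serves to truncate countable unions, because only finite
  unions of compact sets (or of small balls) stay compact (or totally bounded).\<close>

lemma measure_diff_finite_UN_lt:
  assumes B: "\<And>n. B n \<in> sets M" and A: "A \<in> sets M" and "e > 0"
  obtains n :: nat where "measure M (A - (\<Union>i<n. B i)) < measure M (A - (\<Union>i. B i)) + e"
proof -
  have "(\<lambda>n. measure M (A - (\<Union>i<n. B i))) \<longlonglongrightarrow> measure M (\<Inter>n. A - (\<Union>i<n. B i))"
  proof (rule finite_Lim_measure_decseq)
    show "decseq (\<lambda>n. A - (\<Union>i<n. B i))"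
      unfolding decseq_def by fastforce
  qed (use A B in auto)
  moreover have "(\<Inter>n. A - (\<Union>i<n. B i)) = A - (\<Union>i. B i)"
    by auto
  ultimately have "eventually (\<lambda>n. measure M (A - (\<Union>i<n. B i)) < measure M (A - (\<Union>i. B i)) + e) sequentially"
    using \<open>e > 0\<close> by (intro order_tendstoD(2)) auto
  then show ?thesis
    using that by (auto simp: eventually_sequentially)
qed

text \<open>Ulam's theorem. For each n, finitely many closed balls of radius 1/(n+1) miss little
  mass; the intersection over n of these finite unions is closed and totally bounded, hence compact
  by completeness.\<close>

lemma tight:
  assumes "completely_metrizable_space X" "separable_space X" and top: "topspace X = space M"
    and sets: "sets M = borel_sets_of X" and "e > 0"
  obtains K where "compactin X K" "measure M (space M - K) < e"
proof -
  obtain S d where MS: "Metric_space S d" and compl: "Metric_space.mcomplete S d"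
    and X: "X = Metric_space.mtopology S d"
    using assms(1) unfolding completely_metrizable_space_def by blast
  interpret Metric_space S d by fact
  have S: "S = space M"
    using top X by simp
  obtain C where C: "countable C" "C \<subseteq> S" "mtopology closure_of C = S"
    using assms(2) X unfolding separable_space_def by auto
  define c where "c = from_nat_into C"
  have dense: "\<exists>i. d x (c i) < r" if x: "x \<in> S" and r: "r > 0" for x r
  proof -
    have "x \<in> mtopology closure_of C"
      using x C(3) by simp
    then obtain y where "y \<in> C" "y \<in> mball x r"
      using r unfolding metric_closure_of by blast
    then obtain i where "c i = y"
      using C(1) from_nat_into_surj[of C y] unfolding c_def by blast
    with \<open>y \<in> mball x r\<close> show ?thesis
      by auto
  qed
  \<comment> \<open>The guard covers an empty \<open>C\<close>, for which
    \<open>from_nat_into\<close> has an unspecified value.\<close>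
  define B where "B n i = (if c i \<in> S then mcball (c i) (inverse (Suc n)) else {})" for n i :: nat
  have closedB: "closedin X (B n i)" for n i
    by (auto simp: B_def X)
  have B: "B n i \<in> sets M" for n i
    unfolding sets by (intro closedin_borel_sets_of closedB)
  have B_UN: "(\<Union>i. B n i) = S" for n
  proof -
    have "\<exists>i. x \<in> B n i" if x: "x \<in> S" for x
    proof -
      obtain i where "d x (c i) < inverse (Suc n)"
        using dense[OF x, of "inverse (Suc n)"] by auto
      moreover have "c i \<in> S"
        using C(2,3) x from_nat_into[of C i] by (cases "C = {}") (auto simp: c_def)
      ultimately have "x \<in> B n i"
        using x by (auto simp: B_def commute)
      then show ?thesis ..
    qed
    moreover have "B n i \<subseteq> S" for i
      by (auto simp: B_def)
    ultimately show ?thesis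
      by blast
  qed
  have "\<exists>m. measure M (S - (\<Union>i<m. B n i)) < e / 2 * (1/2) ^ Suc n" for n
  proof -
    obtain m where "measure M (S - (\<Union>i<m. B n i)) < measure M (S - (\<Union>i. B n i)) + e / 2 * (1/2) ^ Suc n"
      using measure_diff_finite_UN_lt[of "B n" S "e / 2 * (1/2) ^ Suc n"] B S \<open>e > 0\<close> by auto
    then show ?thesis
      using B_UN[of n] by auto
  qed
  then obtain m where m: "\<And>n. measure M (S - (\<Union>i<m n. B n i)) < e / 2 * (1/2) ^ Suc n"
    by metis
  define K where "K = (\<Inter>n. \<Union>i<m n. B n i)"
  have "closedin X K"
    unfolding K_def by (intro closedin_INT closedin_Union) (auto simp: closedB)
  have "mtotally_bounded K"
    unfolding mtotally_bounded_def
  proof (intro strip)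
    fix r :: real assume "r > 0"
    then obtain n where n: "inverse (Suc n) < r / 2"
      using reals_Archimedean[of "r / 2"] by auto
    \<comment> \<open>Total boundedness asks for centres inside \<open>K\<close>, so each ball that
      meets \<open>K\<close> gets a new centre in \<open>K\<close>. This doubles the radius, hence
      the bound \<open>r / 2\<close> on \<open>inverse (Suc n)\<close>.\<close>
    define I where "I = {i\<in>{..<m n}. K \<inter> B n i \<noteq> {}}"
    have "\<forall>i\<in>I. \<exists>x. x \<in> K \<inter> B n i"
      unfolding I_def by blast
    then obtain p where p: "\<And>i. i \<in> I \<Longrightarrow> p i \<in> K \<inter> B n i"
      by metis
    have "K \<subseteq> (\<Union>x\<in>p ` I. mball x r)"
    proof
      fix x assume x: "x \<in> K"
      then obtain i where i: "i < m n" "x \<in> B n i"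
        unfolding K_def by blast
      then have "i \<in> I"
        using x by (auto simp: I_def)
      then have "p i \<in> B n i"
        using p by blast
      then have "p i \<in> S" "x \<in> S" "c i \<in> S" "d (c i) (p i) \<le> inverse (Suc n)"
        "d (c i) x \<le> inverse (Suc n)"
        using i(2) by (simp_all add: B_def split: if_splits)
      then have "d (p i) x < r" "p i \<in> S" "x \<in> S"
        using n triangle[of "p i" "c i" x] commute[of "p i" "c i"] by linarith+
      then show "x \<in> (\<Union>x\<in>p ` I. mball x r)"
        using \<open>i \<in> I\<close> by auto
    qed
    moreover have "finite (p ` I)"
      by (auto simp: I_def)
    moreover have "p ` I \<subseteq> K"
      using p by blast
    ultimately show "\<exists>F. finite F \<and> F \<subseteq> K \<and> K \<subseteq> (\<Union>x\<in>F. mball x r)"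
      by blast
  qed
  then have "compactin X K"
    using mtotally_bounded_eq_compact_closure_of[OF compl] \<open>closedin X K\<close>
    by (simp add: X closure_of_closedin)
  moreover have "measure M (space M - K) \<le> e / 2"
  proof -
    have "space M - K = (\<Union>n. S - (\<Union>i<m n. B n i))"
      by (auto simp: K_def S)
    moreover have "measure M (\<Union>n. S - (\<Union>i<m n. B n i)) \<le> e / 2"
      using less_imp_le[OF m] by (intro measure_UN_le_geometric sets.Diff sets.finite_UN B) (simp_all add: S)
    ultimately show ?thesis
      by simp
  qed
  ultimately show ?thesis
    using that[of K] \<open>e > 0\<close> by linarith
qed

text \<open>Approximating a set and its complement simultaneously makes the induction over the Borel
  sets symmetric: for a complement, \<open>K\<close> and \<open>L\<close> just swap roles.\<close>

lemma compact_inner_regular: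
  assumes X: "completely_metrizable_space X" "separable_space X" and top: "topspace X = space M"
    and sets: "sets M = borel_sets_of X" and "A \<in> sets M" and "e > 0"
  obtains K L where "compactin X K" "compactin X L" "K \<subseteq> A" "L \<subseteq> space M - A"
    "measure M (space M - K - L) < e"
proof -
  have Haus: "Hausdorff_space X"
    using X(1) completely_metrizable_imp_metrizable_space metrizable_imp_Hausdorff_space by blast
  have clos: "closedin X K" if "compactin X K" for K
    using compactin_imp_closedin[OF Haus that] .
  have cs: "K \<in> sets M" if "compactin X K" for K
    unfolding sets by (intro closedin_borel_sets_of clos that)
  have "A \<in> sigma_sets (topspace X) {U. openin X U}"
    using assms by (simp add: borel_sets_of_def)
  then have "\<forall>e>0. \<exists>K L. compactin X K \<and> compactin X L \<and> K \<subseteq> A \<and> L \<subseteq> space M - A \<and>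
      measure M (space M - K - L) < e"
  proof (induction rule: sigma_sets.induct)
    case (Basic U)
    then have U: "openin X U" by simp
    have Us: "U \<in> sets M"
      unfolding sets by (rule openin_borel_sets_of[OF U])
    obtain C where C: "\<And>n::nat. closedin X (C n)" "(\<Union>n. C n) = U"
      using open_imp_fsigma_in[OF completely_metrizable_imp_metrizable_space[OF X(1)] U]
      unfolding fsigma_in_ascending by auto
    show ?case
    proof (intro strip)
      fix e :: real assume "e > 0"
      \<comment> \<open>The sets \<open>C i\<close> and the complement of \<open>U\<close> are
        merely closed; intersecting them with \<open>K0\<close> makes them compact.\<close>
      obtain K0 where K0: "compactin X K0" "measure M (space M - K0) < e / 2"
        using tight[OF X top sets, of "e / 2"] \<open>e > 0\<close> by auto
      have Cs: "C n \<in> sets M" for n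
        unfolding sets by (intro closedin_borel_sets_of C)
      obtain n :: nat where n: "measure M (U - (\<Union>i<n. C i)) < measure M (U - (\<Union>i. C i)) + e / 2"
        using measure_diff_finite_UN_lt[where B = C, OF Cs Us, of "e / 2"] \<open>e > 0\<close> by auto
      have "compactin X (K0 \<inter> (\<Union>i<n. C i))"
        using C by (intro compact_Int_closedin K0 closedin_Union) auto
      moreover have "compactin X (K0 \<inter> (topspace X - U))"
        using U by (intro compact_Int_closedin K0) auto
      moreover have "measure M (space M - K0 \<inter> (\<Union>i<n. C i) - K0 \<inter> (topspace X - U)) < e"
      proof -
        have "measure M (space M - K0 \<inter> (\<Union>i<n. C i) - K0 \<inter> (topspace X - U))
            \<le> measure M ((space M - K0) \<union> (U - (\<Union>i<n. C i)))"
          using Us Cs cs[OF K0(1)] by (intro finite_measure_mono) (auto simp: top)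
        also have "\<dots> \<le> measure M (space M - K0) + measure M (U - (\<Union>i<n. C i))"
          using Us Cs cs[OF K0(1)] by (intro measure_Un_le) auto
        also have "\<dots> < e"
          using K0 n C by simp
        finally show ?thesis .
      qed
      ultimately show "\<exists>K L. compactin X K \<and> compactin X L \<and> K \<subseteq> U \<and> L \<subseteq> space M - U \<and>
          measure M (space M - K - L) < e"
        using C(2) by (intro exI[of _ "K0 \<inter> (\<Union>i<n. C i)"] exI[of _ "K0 \<inter> (topspace X - U)"]) (auto simp: top)
    qed
  next
    case Empty
    show ?case
    proof (intro strip)
      fix e :: real assume "e > 0"
      then obtain K0 where K0: "compactin X K0" "measure M (space M - K0) < e"
        using tight[OF X top sets] by blast
      then show "\<exists>K L. compactin X K \<and> compactin X L \<and> K \<subseteq> {} \<and> L \<subseteq> space M - {} \<and>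
          measure M (space M - K - L) < e"
        using compactin_subset_topspace[OF K0(1)] top
        by (intro exI[of _ "{}"] exI[of _ K0]) auto
    qed
  next
    case (Compl a)
    have a: "a \<subseteq> space M"
      using sigma_sets_into_sp[OF _ Compl.hyps] openin_subset top by blast
    have eq: "space M - K - L = space M - L - K" for K L :: "'a set" by blast
    show ?case
    proof (intro strip)
      fix e :: real assume "e > 0"
      then obtain K L where "compactin X K" "compactin X L" "K \<subseteq> a" "L \<subseteq> space M - a"
        "measure M (space M - K - L) < e"
        using Compl.IH by blast
      then show "\<exists>K L. compactin X K \<and> compactin X L \<and> K \<subseteq> topspace X - a \<and>
          L \<subseteq> space M - (topspace X - a) \<and> measure M (space M - K - L) < e"
        using a eq top by (intro exI[of _ L] exI[of _ K]) auto
    qed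
  next
    case (Union a)
    show ?case
    proof (intro strip)
      fix e :: real assume "e > 0"
      have "\<exists>K L. compactin X K \<and> compactin X L \<and> K \<subseteq> a i \<and> L \<subseteq> space M - a i \<and>
          measure M (space M - K - L) < e / 2 * (1/2) ^ Suc i" for i
      proof -
        have "0 < e / 2 * (1/2) ^ Suc i"
          using \<open>e > 0\<close> by simp
        then show ?thesis
          using Union.IH[of i] by blast
      qed
      then obtain K L where K: "\<And>i. compactin X (K i)" and L: "\<And>i. compactin X (L i)"
        and KL: "\<And>i. K i \<subseteq> a i" "\<And>i. L i \<subseteq> space M - a i"
        and m: "\<And>i::nat. measure M (space M - K i - L i) < e / 2 * (1/2) ^ Suc i"
        by metis
      \<comment> \<open>The inner sets for the complements can be intersected all at once, whereas
        the union of the \<open>K i\<close> must be cut off at a finite stage. Each of the two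
        operations costs at most \<open>e / 2\<close>.\<close>
      define L' where "L' = (\<Inter>i. L i)"
      have L': "compactin X L'"
        unfolding L'_def by (rule closed_compactin_Inter[of X "L 0"]) (use L clos in auto)
      have L'_sub: "L' \<subseteq> space M - (\<Union>i. a i)"
        using KL(2) unfolding L'_def by blast
      have s: "K i \<in> sets M" "L i \<in> sets M" "L' \<in> sets M" for i
        using cs K L L' by auto
      obtain n :: nat where n: "measure M ((space M - L') - (\<Union>i<n. K i)) <
          measure M ((space M - L') - (\<Union>i. K i)) + e / 2"
        using measure_diff_finite_UN_lt[of K "space M - L'" "e / 2"] s \<open>e > 0\<close> by auto
      have "measure M ((space M - L') - (\<Union>i. K i)) \<le> measure M (\<Union>i. space M - K i - L i)"
        using s by (intro finite_measure_mono) (auto simp: L'_def)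
      also have "\<dots> \<le> e / 2"
        using less_imp_le[OF m] by (intro measure_UN_le_geometric sets.Diff sets.top s)
      finally have "measure M (space M - (\<Union>i<n. K i) - L') < e"
        using n by (simp add: Diff_eq Int_ac)
      moreover have "compactin X (\<Union>i<n. K i)"
        using K by (intro compactin_Union) auto
      ultimately show "\<exists>K L. compactin X K \<and> compactin X L \<and> K \<subseteq> (\<Union>i. a i) \<and>
          L \<subseteq> space M - (\<Union>i. a i) \<and> measure M (space M - K - L) < e"
        using L' KL(1) L'_sub by (intro exI[of _ "\<Union>i<n. K i"] exI[of _ L']) blast
    qed
  qed
  then show ?thesis
    using that \<open>e > 0\<close> by blast
qed


text \<open>The preimage of each basic open set is enclosed between a compact \<open>K n\<close>
  inside it and the complement of a compact \<open>L n\<close> outside it. On a set contained in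
  every \<open>K n \<union> L n\<close>, this preimage is the trace of the open complement of
  \<open>L n\<close>, so the restriction of \<open>f\<close> is continuous.\<close>

lemma lusin:
  assumes X: "completely_metrizable_space X" "separable_space X" and top: "topspace X = space M"
    and sets: "sets M = borel_sets_of X" and "e > 0"
    and Y: "second_countable Y" and F: "F \<in> sets M" and fF: "f ` F \<subseteq> topspace Y"
    and f: "\<And>U. openin Y U \<Longrightarrow> f -` U \<inter> F \<in> sets M"
  obtains K where "compactin X K" "K \<subseteq> F" "continuous_map (subtopology X K) Y f"
    "measure M (F - K) < e"
proof -
  have Haus: "Hausdorff_space X"
    using X(1) completely_metrizable_imp_metrizable_space metrizable_imp_Hausdorff_space by blast
  have clos: "closedin X K" if "compactin X K" for K
    using compactin_imp_closedin[OF Haus that] .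
  have cs: "K \<in> sets M" if "compactin X K" for K
    unfolding sets by (intro closedin_borel_sets_of clos that)
  obtain \<B> where \<B>: "countable \<B>" "\<And>V. V \<in> \<B> \<Longrightarrow> openin Y V"
      "\<And>U x. openin Y U \<Longrightarrow> x \<in> U \<Longrightarrow> \<exists>V\<in>\<B>. x \<in> V \<and> V \<subseteq> U"
    using Y unfolding second_countable_def by metis
  \<comment> \<open>Inserting the empty set keeps all values of the enumeration open even if the
    base is empty.\<close>
  define b where "b = from_nat_into (insert {} \<B>)"
  have b_open: "openin Y (b n)" for n
    using \<B>(2) from_nat_into[of "insert {} \<B>" n] by (auto simp: b_def)
  have b_basis: "\<exists>n. x \<in> b n \<and> b n \<subseteq> U" if "openin Y U" "x \<in> U" for U x
  proof -
    obtain V where "V \<in> \<B>" "x \<in> V" "V \<subseteq> U"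
      using \<B>(3)[OF \<open>openin Y U\<close> \<open>x \<in> U\<close>] by blast
    moreover then obtain n where "b n = V"
      using from_nat_into_surj[of "insert {} \<B>" V] \<B>(1) by (auto simp: b_def)
    ultimately show ?thesis
      by blast
  qed
  have "\<exists>K L. compactin X K \<and> compactin X L \<and> K \<subseteq> f -` b n \<inter> F \<and> L \<subseteq> space M - (f -` b n \<inter> F) \<and>
      measure M (space M - K - L) < e / 4 * (1/2) ^ Suc n" for n
  proof -
    have pos: "0 < e / 4 * (1/2) ^ Suc n"
      using \<open>e > 0\<close> by simp
    show ?thesis
      by (rule compact_inner_regular[OF X top sets f[OF b_open[of n]] pos]) blast
  qed
  then obtain K L where K: "\<And>n. compactin X (K n)" and L: "\<And>n. compactin X (L n)"
    and KL: "\<And>n. K n \<subseteq> f -` b n \<inter> F" "\<And>n. L n \<subseteq> space M - (f -` b n \<inter> F)"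
    and m: "\<And>n. measure M (space M - K n - L n) < e / 4 * (1/2) ^ Suc n"
    by metis
  obtain K' L' where K': "compactin X K'" "compactin X L'" "K' \<subseteq> F" "L' \<subseteq> space M - F"
    "measure M (space M - K' - L') < e / 2"
    using compact_inner_regular[OF X top sets F, of "e / 2"] \<open>e > 0\<close> by auto
  define C where "C = K' \<inter> (\<Inter>n. K n \<union> L n)"
  have "compactin X C"
    unfolding C_def
  proof (intro compact_Int_closedin K'(1) closedin_INT)
    show "closedin X (K n \<union> L n)" for n
      using clos[OF K] clos[OF L] by (intro closedin_Un)
  qed auto
  moreover have CF: "C \<subseteq> F"
    using K' by (auto simp: C_def)
  moreover have "continuous_map (subtopology X C) Y f"
    unfolding continuous_map_def
  proof (intro conjI strip)
    show "f \<in> topspace (subtopology X C) \<rightarrow> topspace Y"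
      using CF fF by auto
    fix U assume U: "openin Y U"
    define W where "W = (\<Union>n\<in>{n. b n \<subseteq> U}. topspace X - L n)"
    have W: "openin X W"
      unfolding W_def using clos[OF L] by (intro openin_Union) auto
    have "x \<in> W" if x: "x \<in> C" "f x \<in> U" for x
    proof -
      obtain n where "f x \<in> b n" "b n \<subseteq> U"
        using b_basis[OF U x(2)] by blast
      moreover have "x \<in> F" "x \<in> topspace X"
        using x CF F sets.sets_into_space top by auto
      ultimately show ?thesis
        using KL(2)[of n] unfolding W_def by blast
    qed
    moreover have "f x \<in> U" if x: "x \<in> C" "x \<in> W" for x
    proof -
      obtain n where "x \<notin> L n" "b n \<subseteq> U"
        using x by (auto simp: W_def)
      moreover then have "x \<in> K n"
        using x unfolding C_def by blast
      ultimately show ?thesis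
        using KL(1)[of n] by blast
    qed
    moreover have "C \<subseteq> topspace X"
      using CF sets.sets_into_space[OF F] top by auto
    ultimately have "{x \<in> topspace (subtopology X C). f x \<in> U} = W \<inter> C"
      by auto
    then show "openin (subtopology X C) {x \<in> topspace (subtopology X C). f x \<in> U}"
      using W by (auto simp: openin_subtopology)
  qed
  moreover have "measure M (F - C) < e"
  proof -
    have s: "K n \<in> sets M" "L n \<in> sets M" "K' \<in> sets M" "L' \<in> sets M" for n
      using cs[OF K] cs[OF L] cs[OF K'(1)] cs[OF K'(2)] by auto
    have "measure M (F - C) \<le> measure M ((space M - K' - L') \<union> (\<Union>n. space M - K n - L n))"
    proof (rule finite_measure_mono)
      show "F - C \<subseteq> (space M - K' - L') \<union> (\<Union>n. space M - K n - L n)"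
        using K'(4) sets.sets_into_space[OF F] unfolding C_def by blast
    qed (use s in auto)
    also have "\<dots> \<le> measure M (space M - K' - L') + measure M (\<Union>n. space M - K n - L n)"
      using s by (intro measure_Un_le) auto
    also have "measure M (\<Union>n. space M - K n - L n) \<le> e / 4"
      using less_imp_le[OF m] by (intro measure_UN_le_geometric sets.Diff sets.top s)
    finally show ?thesis
      using K'(5) \<open>e > 0\<close> by linarith
  qed
  ultimately show ?thesis
    by (rule that)
qed

end

text \<open>Images of compact sets are compact, hence closed in a Hausdorff space. Injectivity makes
  images commute with complements relative to \<open>K\<close>, which carries Borel images from
  closed sets to open ones and through the induction.\<close>

lemma injective_compact_image_borel:
  assumes K: "compactin X K" and f: "continuous_map (subtopology X K) Y f" and Y: "Hausdorff_space Y"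
    and inj: "inj_on f K" and "A \<in> borel_sets_of X"
  shows "f ` (A \<inter> K) \<in> borel_sets_of Y"
proof -
  interpret Y: sigma_algebra "topspace Y" "borel_sets_of Y"
    by (rule sigma_algebra_borel_sets_of)
  have closed: "f ` C \<in> borel_sets_of Y" if "compactin X C" "C \<subseteq> K" for C
    using image_compactin[OF _ f, of C] that
    by (intro closedin_borel_sets_of compactin_imp_closedin[OF Y]) (simp add: compactin_subtopology)
  have fK: "f ` K \<in> borel_sets_of Y"
    by (rule closed[OF K]) simp
  have "A \<in> sigma_sets (topspace X) {U. openin X U}"
    using assms by (simp add: borel_sets_of_def)
  then show ?thesis
  proof (induction rule: sigma_sets.induct)
    case (Basic U)
    then have "f ` (K \<inter> (topspace X - U)) \<in> borel_sets_of Y"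
      by (intro closed compact_Int_closedin K) auto
    moreover have "f ` (U \<inter> K) = f ` K - f ` (K \<inter> (topspace X - U))"
      using inj compactin_subset_topspace[OF K] by (auto simp: inj_on_def)
    ultimately show ?case
      using fK by auto
  next
    case (Compl a)
    moreover have "f ` ((topspace X - a) \<inter> K) = f ` K - f ` (a \<inter> K)"
      using inj compactin_subset_topspace[OF K] by (auto simp: inj_on_def)
    ultimately show ?case
      using fK by auto
  next
    case (Union a)
    then have "(\<Union>i. f ` (a i \<inter> K)) \<in> borel_sets_of Y"
      by auto
    moreover have "f ` (\<Union> (range a) \<inter> K) = (\<Union>i. f ` (a i \<inter> K))"
      by auto
    ultimately show ?case
      by simp
  qed auto
qed

text \<open>
  A substitute, up to null sets, for the Lusin--Souslin theorem on injective Borel images.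
\<close>

lemma (in sigma_finite_measure) injective_borel_image_mod0:
  assumes std: "standard_borel M" and Y: "second_countable Y" "Hausdorff_space Y"
    and F: "F \<in> sets M" and fF: "f ` F \<subseteq> topspace Y" and inj: "inj_on f F"
    and f: "\<And>U. openin Y U \<Longrightarrow> f -` U \<inter> F \<in> sets M"
  shows "\<exists>V\<in>sets M. V \<subseteq> F \<and> emeasure M (F - V) = 0 \<and>
    (\<forall>A\<in>sets M. A \<subseteq> V \<longrightarrow> f ` A \<in> borel_sets_of Y)"
proof -
  interpret Y: sigma_algebra "topspace Y" "borel_sets_of Y"
    by (rule sigma_algebra_borel_sets_of)
  obtain X where X: "completely_metrizable_space X" "separable_space X" "topspace X = space M"
    "sets M = borel_sets_of X"
    using std unfolding standard_borel_def by blast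
  \<comment> \<open>The approximation results need a finite measure. A strictly positive integrable
    density produces one whose null sets are null for \<open>M\<close>.\<close>
  obtain h where h: "h \<in> borel_measurable M" "integral\<^sup>N M h \<noteq> \<infinity>" "\<And>x. x \<in> space M \<Longrightarrow> 0 < h x"
    using Ex_finite_integrable_function by blast
  define N where "N = density M h"
  have N: "sets N = sets M" "space N = space M"
    by (simp_all add: N_def)
  interpret N: finite_measure N
    by (rule finite_measureI)
       (use h in \<open>simp add: N_def emeasure_density cong: nn_integral_cong\<close>)
  have null: "A \<in> null_sets M" if "A \<in> null_sets N" for A
  proof -
    have A: "A \<in> sets M" and "AE x in M. x \<in> A \<longrightarrow> h x = 0"
      using that null_sets_density_iff[OF h(1), of A] by (auto simp: N_def)
    from this(2) AE_space have "AE x in M. x \<notin> A"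
      by eventually_elim (use h(3) in fastforce)
    then show ?thesis
      using A by (simp add: AE_iff_null_sets)
  qed
  have "\<exists>K. compactin X K \<and> K \<subseteq> F \<and> continuous_map (subtopology X K) Y f \<and>
      measure N (F - K) < inverse (Suc n)" for n
    by (rule N.lusin[of X "inverse (Suc n)" Y F f]) (use X N Y F fF f in auto)
  then obtain K where K: "\<And>n. compactin X (K n)" "\<And>n. K n \<subseteq> F"
    "\<And>n. continuous_map (subtopology X (K n)) Y f" "\<And>n. measure N (F - K n) < inverse (Suc n)"
    by metis
  have Ks: "K n \<in> sets M" for n
    unfolding X
    by (intro closedin_borel_sets_of compactin_imp_closedin[OF _ K(1)] metrizable_imp_Hausdorff_space
        completely_metrizable_imp_metrizable_space X)
  define V where "V = (\<Union>n. K n)"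
  have V: "V \<in> sets M"
    using Ks by (auto simp: V_def)
  have "measure N (F - V) \<le> inverse (Suc n)" for n
  proof -
    have "measure N (F - V) \<le> measure N (F - K n)"
      using Ks F by (intro N.finite_measure_mono) (auto simp: V_def N)
    then show ?thesis
      using K(4)[of n] by linarith
  qed
  then have "measure N (F - V) \<le> 0"
    using LIMSEQ_inverse_real_of_nat by (intro LIMSEQ_le_const) auto
  then have "F - V \<in> null_sets N"
    using V F by (auto simp: null_sets_def N N.emeasure_eq_measure measure_le_0_iff)
  then have "emeasure M (F - V) = 0"
    using null by auto
  moreover have "f ` A \<in> borel_sets_of Y" if A: "A \<in> sets M" "A \<subseteq> V" for A
  proof -
    have "f ` (A \<inter> K n) \<in> borel_sets_of Y" for n
      using injective_compact_image_borel[OF K(1) K(3) Y(2)] A X inj_on_subset[OF inj K(2)] by auto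
    then have "(\<Union>n. f ` (A \<inter> K n)) \<in> borel_sets_of Y"
      by auto
    moreover have "(\<Union>n. f ` (A \<inter> K n)) = f ` A"
      using A unfolding V_def by blast
    ultimately show ?thesis
      by simp
  qed
  ultimately show ?thesis
    using V K(2) by (intro bexI[of _ V]) (auto simp: V_def)
qed

subsection \<open>Contractions with a recurrent dense orbit\<close>

text \<open>The lower bound \<open>k\<close> in \<open>recurrent\<close> makes the orbit of
  \<open>z\<close> return near every point at arbitrarily late times, in particular near
  \<open>z\<close> itself. The absence of isolated points is there because
  \<open>omega_limit\<close> is formed with accumulation points.\<close>

locale recurrent_contraction = Metric_space F d for F :: "'a set" and d +
  fixes T :: "'a \<Rightarrow> 'a" and z :: 'a
  assumes T_in: "\<And>x. x \<in> F \<Longrightarrow> T x \<in> F"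
    and contraction: "\<And>x y. x \<in> F \<Longrightarrow> y \<in> F \<Longrightarrow> d (T x) (T y) \<le> d x y"
    and z_in: "z \<in> F"
    and recurrent: "\<And>x \<epsilon> k. x \<in> F \<Longrightarrow> \<epsilon> > 0 \<Longrightarrow> \<exists>n\<ge>k. d x ((T ^^ n) z) < \<epsilon>"
    and bounded: "\<And>x y. x \<in> F \<Longrightarrow> y \<in> F \<Longrightarrow> d x y \<le> 1"
    and not_isolated: "\<And>x \<epsilon>. x \<in> F \<Longrightarrow> \<epsilon> > 0 \<Longrightarrow> \<exists>y\<in>F. y \<noteq> x \<and> d x y < \<epsilon>"
begin

abbreviation u :: "nat \<Rightarrow> 'a" where "u n \<equiv> (T ^^ n) z"

lemma pow_in: "x \<in> F \<Longrightarrow> (T ^^ n) x \<in> F"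
  by (induction n) (auto simp: T_in)

lemma u_in: "u n \<in> F"
  by (rule pow_in[OF z_in])

lemma contraction_pow: "x \<in> F \<Longrightarrow> y \<in> F \<Longrightarrow> d ((T ^^ n) x) ((T ^^ n) y) \<le> d x y"
proof (induction n)
  case (Suc n)
  then show ?case
    using contraction[OF pow_in[of x n] pow_in[of y n]] by simp
qed simp

text \<open>If T^n z is close to \<open>z\<close>, then T^n moves every orbit point T^m z at most as
  far, because T^m commutes with T^n and contracts. Density of the orbit extends this to all points,
  with the same n.\<close>

lemma rigid:
  assumes "\<epsilon> > 0"
  shows "\<exists>n\<ge>k. \<forall>x\<in>F. d ((T ^^ n) x) x < \<epsilon>"
proof -
  obtain n where n: "n \<ge> k" "d z (u n) < \<epsilon> / 3"
    using recurrent[OF z_in, of "\<epsilon> / 3" k] assms by auto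
  have "d ((T ^^ n) x) x < \<epsilon>" if x: "x \<in> F" for x
  proof -
    obtain m where m: "d x (u m) < \<epsilon> / 3"
      using recurrent[OF x, of "\<epsilon> / 3" 0] assms by auto
    have "(T ^^ n) (u m) = (T ^^ m) (u n)"
      by (metis add.commute comp_apply funpow_add)
    then have "d ((T ^^ n) (u m)) (u m) \<le> d (u n) z"
      using contraction_pow[OF u_in[of n] z_in, of m] by simp
    moreover have "d ((T ^^ n) x) x \<le> d ((T ^^ n) x) ((T ^^ n) (u m)) + d ((T ^^ n) (u m)) x"
      using triangle pow_in x u_in by blast
    moreover have "d ((T ^^ n) (u m)) x \<le> d ((T ^^ n) (u m)) (u m) + d (u m) x"
      using triangle pow_in x u_in by blast
    ultimately show ?thesis
      using contraction_pow[OF x u_in, of n m] m n(2) by (simp add: commute)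
  qed
  then show ?thesis
    using n by blast
qed

text \<open>A power T^n with n at least 1 that is almost the identity factors as T^m after
  \<open>T\<close>. Since T^m contracts, \<open>T\<close> can have lost almost no distance.\<close>

lemma isometry:
  assumes x: "x \<in> F" and y: "y \<in> F"
  shows "d (T x) (T y) = d x y"
proof (rule antisym[OF contraction[OF x y]], rule field_le_epsilon)
  fix \<epsilon> :: real assume "\<epsilon> > 0"
  then obtain n where n: "n \<ge> 1" "\<forall>x\<in>F. d ((T ^^ n) x) x < \<epsilon> / 2"
    using rigid[of "\<epsilon> / 2" 1] by auto
  then obtain m where m: "n = Suc m"
    by (cases n) auto
  have "d ((T ^^ n) x) ((T ^^ n) y) \<le> d (T x) (T y)"
    using contraction_pow[OF T_in[OF x] T_in[OF y], of m] m by (simp add: funpow_swap1)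
  moreover have "d x y \<le> d x ((T ^^ n) x) + d ((T ^^ n) x) y"
    using triangle pow_in x y by blast
  moreover have "d ((T ^^ n) x) y \<le> d ((T ^^ n) x) ((T ^^ n) y) + d ((T ^^ n) y) y"
    using triangle pow_in x y by blast
  moreover have "d ((T ^^ n) x) x < \<epsilon> / 2" "d ((T ^^ n) y) y < \<epsilon> / 2"
    using n(2) x y by auto
  ultimately show "d x y \<le> d (T x) (T y) + \<epsilon>"
    by (simp add: commute)
qed

text \<open>
  The completion is the uniform closure of the Kuratowski embedding along the dense orbit of \<open>z\<close>.
  In these coordinates the inverse of \<open>T\<close> is the left shift.
\<close>

definition embed :: "'a \<Rightarrow> nat \<Rightarrow> real" where
  "embed x = (\<lambda>k. d x (u k))"

definition compl :: "(nat \<Rightarrow> real) set" where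
  "compl = {a. \<forall>\<epsilon>>0. \<exists>x\<in>F. \<forall>k. \<bar>a k - embed x k\<bar> \<le> \<epsilon>}"

text \<open>The value 0 off \<open>compl\<close> is chosen because \<open>Metric_space\<close>
  demands symmetry and nonnegativity for all arguments.\<close>

definition sup_dist :: "(nat \<Rightarrow> real) \<Rightarrow> (nat \<Rightarrow> real) \<Rightarrow> real" where
  "sup_dist a b = (if a \<in> compl \<and> b \<in> compl then SUP k. \<bar>a k - b k\<bar> else 0)"

definition shift :: "(nat \<Rightarrow> real) \<Rightarrow> nat \<Rightarrow> real" where
  "shift a = (\<lambda>k. a (Suc k))"

text \<open>Applying \<open>T\<close> shifts the coordinates to the right, and the new coordinate 0,
  the distance from \<open>T x\<close> to \<open>z\<close>, would have to be recovered as a limit of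
  old ones. Inverting the left shift avoids that formula.\<close>

definition ext :: "(nat \<Rightarrow> real) \<Rightarrow> nat \<Rightarrow> real" where
  "ext = inv_into compl shift"

section \<open>The supremum metric on the completion\<close>

lemma embed_in: "x \<in> F \<Longrightarrow> embed x \<in> compl"
  unfolding compl_def by force

lemma compl_bounded:
  assumes "a \<in> compl"
  shows "\<bar>a k\<bar> \<le> 2"
proof -
  obtain x where "x \<in> F" "\<bar>a k - embed x k\<bar> \<le> 1"
    using assms zero_less_one unfolding compl_def by blast
  then show ?thesis
    using bounded[OF \<open>x \<in> F\<close> u_in[of k]] nonneg[of x "u k"] unfolding embed_def by linarith
qed

lemma sup_dist_le_iff:
  assumes "a \<in> compl" "b \<in> compl"
  shows "sup_dist a b \<le> r \<longleftrightarrow> (\<forall>k. \<bar>a k - b k\<bar> \<le> r)"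
proof -
  have "\<bar>a k - b k\<bar> \<le> 4" for k
    using compl_bounded[OF assms(1), of k] compl_bounded[OF assms(2), of k] by linarith
  then have "bdd_above (range (\<lambda>k. \<bar>a k - b k\<bar>))"
    by (intro bdd_aboveI[of _ 4]) auto
  then show ?thesis
    using assms by (simp add: sup_dist_def cSUP_le_iff)
qed

lemma sup_dist_ge:
  assumes "a \<in> compl" "b \<in> compl"
  shows "\<bar>a k - b k\<bar> \<le> sup_dist a b"
  using sup_dist_le_iff[OF assms] by blast

sublocale C: Metric_space compl sup_dist
proof
  show "0 \<le> sup_dist a b" for a b
    using sup_dist_ge[of a b 0] abs_ge_zero[of "a 0 - b 0"] by (cases "a \<in> compl \<and> b \<in> compl") (auto simp: sup_dist_def)
  show "sup_dist a b = sup_dist b a" for a b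
    by (simp add: sup_dist_def abs_minus_commute)
  show "sup_dist a b = 0 \<longleftrightarrow> a = b" if "a \<in> compl" "b \<in> compl" for a b
  proof
    assume "sup_dist a b = 0"
    then have "a k = b k" for k
      using sup_dist_ge[OF that, of k] by simp
    then show "a = b" ..
  qed (use that in \<open>simp add: sup_dist_def\<close>)
  show "sup_dist a c \<le> sup_dist a b + sup_dist b c"
    if "a \<in> compl" "b \<in> compl" "c \<in> compl" for a b c
  proof -
    have "\<bar>a k - c k\<bar> \<le> sup_dist a b + sup_dist b c" for k
      using sup_dist_ge[of a b k] sup_dist_ge[of b c k] that by linarith
    then show ?thesis
      using that by (simp add: sup_dist_le_iff)
  qed
qed

text \<open>Kuratowski's argument: every coordinate obeys the triangle inequality, and a coordinate
  whose orbit point is close to \<open>x\<close> almost attains the distance.\<close>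

lemma sup_dist_embed:
  assumes x: "x \<in> F" and y: "y \<in> F"
  shows "sup_dist (embed x) (embed y) = d x y"
proof (rule antisym)
  have "\<bar>embed x k - embed y k\<bar> \<le> d x y" for k
    using triangle[OF x y u_in[of k]] triangle[OF y x u_in[of k]] commute[of x y]
    unfolding embed_def by linarith
  then show "sup_dist (embed x) (embed y) \<le> d x y"
    using embed_in x y by (simp add: sup_dist_le_iff)
  show "d x y \<le> sup_dist (embed x) (embed y)"
  proof (rule field_le_epsilon)
    fix \<epsilon> :: real assume "\<epsilon> > 0"
    then obtain n where "d x (u n) < \<epsilon> / 2"
      using recurrent[OF x, of "\<epsilon> / 2" 0] by auto
    moreover have "\<bar>embed x n - embed y n\<bar> \<le> sup_dist (embed x) (embed y)"
      using embed_in x y by (intro sup_dist_ge)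
    ultimately show "d x y \<le> sup_dist (embed x) (embed y) + \<epsilon>"
      using triangle[OF x u_in y, of n] commute[of y "u n"] unfolding embed_def by linarith
  qed
qed

lemma inj_embed: "inj_on embed F"
  using sup_dist_embed embed_in by (metis C.zero inj_onI zero)

text \<open>The bound \<open>k\<close> is kept so that later proofs can ask for a predecessor in the
  orbit, or for an orbit point that comes after a given one.\<close>

lemma embed_dense:
  assumes "a \<in> compl" "\<epsilon> > 0"
  shows "\<exists>n\<ge>k. sup_dist a (embed (u n)) < \<epsilon>"
proof -
  have "\<epsilon> / 2 > 0"
    using assms by simp
  then obtain x where x: "x \<in> F" "\<forall>k. \<bar>a k - embed x k\<bar> \<le> \<epsilon> / 2"
    using assms(1) unfolding compl_def by blast
  then have "sup_dist a (embed x) \<le> \<epsilon> / 2"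
    using sup_dist_le_iff[OF assms(1) embed_in[OF x(1)]] by blast
  moreover obtain n where "n \<ge> k" "d x (u n) < \<epsilon> / 2"
    using recurrent[OF x(1) \<open>\<epsilon> / 2 > 0\<close>] by blast
  moreover have "sup_dist a (embed (u n)) \<le> sup_dist a (embed x) + sup_dist (embed x) (embed (u n))"
    using assms x u_in embed_in by (intro C.triangle) auto
  ultimately show ?thesis
    using sup_dist_embed[OF x(1) u_in[of n]] by (intro exI[of _ n]) auto
qed

lemma mcomplete_compl: "C.mcomplete"
  unfolding C.mcomplete_def
proof (intro strip)
  fix \<sigma> assume "C.MCauchy \<sigma>"
  then have \<sigma>: "\<And>n. \<sigma> n \<in> compl" and
    cauchy: "\<And>\<epsilon>. \<epsilon> > 0 \<Longrightarrow> \<exists>N. \<forall>n n'. N \<le> n \<longrightarrow> N \<le> n' \<longrightarrow> sup_dist (\<sigma> n) (\<sigma> n') < \<epsilon>"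
    unfolding C.MCauchy_def by auto
  have "\<exists>l. (\<lambda>n. \<sigma> n k) \<longlonglongrightarrow> l" for k
  proof -
    have "Cauchy (\<lambda>n. \<sigma> n k)"
    proof (rule metric_CauchyI)
      fix \<epsilon> :: real assume "\<epsilon> > 0"
      then obtain N where N: "\<And>n n'. N \<le> n \<Longrightarrow> N \<le> n' \<Longrightarrow> sup_dist (\<sigma> n) (\<sigma> n') < \<epsilon>"
        using cauchy by blast
      show "\<exists>N. \<forall>m\<ge>N. \<forall>n\<ge>N. dist (\<sigma> m k) (\<sigma> n k) < \<epsilon>"
        using N sup_dist_ge[OF \<sigma> \<sigma>, of _ k] unfolding dist_real_def
        by (meson order.strict_trans1)
    qed
    then show ?thesis
      by (simp add: Cauchy_convergent convergentD)
  qed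
  then obtain a where a: "\<And>k. (\<lambda>n. \<sigma> n k) \<longlonglongrightarrow> a k"
    by metis
  \<comment> \<open>Letting m tend to infinity in the Cauchy estimate makes the coordinatewise
    convergence uniform.\<close>
  have close: "\<exists>N. \<forall>n\<ge>N. \<forall>k. \<bar>\<sigma> n k - a k\<bar> \<le> \<epsilon>" if pos: "\<epsilon> > 0" for \<epsilon>
  proof -
    obtain N where N: "\<And>n n'. N \<le> n \<Longrightarrow> N \<le> n' \<Longrightarrow> sup_dist (\<sigma> n) (\<sigma> n') < \<epsilon>"
      using cauchy[OF pos] by blast
    have "\<bar>\<sigma> n k - a k\<bar> \<le> \<epsilon>" if "n \<ge> N" for n k
    proof (rule LIMSEQ_le_const2)
      show "(\<lambda>m. \<bar>\<sigma> n k - \<sigma> m k\<bar>) \<longlonglongrightarrow> \<bar>\<sigma> n k - a k\<bar>"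
        by (intro tendsto_intros a)
      show "\<exists>N. \<forall>m\<ge>N. \<bar>\<sigma> n k - \<sigma> m k\<bar> \<le> \<epsilon>"
        using N[OF that] sup_dist_ge[OF \<sigma> \<sigma>, of n k] by (meson less_imp_le order.trans)
    qed
    then show ?thesis
      by blast
  qed
  have "a \<in> compl"
    unfolding compl_def
  proof (intro CollectI strip)
    fix \<epsilon> :: real assume "\<epsilon> > 0"
    then have pos: "\<epsilon> / 2 > 0"
      by simp
    then obtain N where N: "\<And>k. \<bar>\<sigma> N k - a k\<bar> \<le> \<epsilon> / 2"
      using close by blast
    obtain x where x: "x \<in> F" "\<And>k. \<bar>\<sigma> N k - embed x k\<bar> \<le> \<epsilon> / 2"
      using \<sigma>[of N] pos unfolding compl_def by blast
    have "\<bar>a k - embed x k\<bar> \<le> \<epsilon>" for k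
      using N[of k] x(2)[of k] by linarith
    then show "\<exists>x\<in>F. \<forall>k. \<bar>a k - embed x k\<bar> \<le> \<epsilon>"
      using x(1) by blast
  qed
  moreover have "\<exists>N. \<forall>n\<ge>N. \<sigma> n \<in> compl \<and> sup_dist (\<sigma> n) a < \<epsilon>" if "\<epsilon> > 0" for \<epsilon>
  proof -
    obtain N where N: "\<And>n k. n \<ge> N \<Longrightarrow> \<bar>\<sigma> n k - a k\<bar> \<le> \<epsilon> / 2"
      using close[of "\<epsilon> / 2"] \<open>\<epsilon> > 0\<close> by auto
    have "sup_dist (\<sigma> n) a \<le> \<epsilon> / 2" if "n \<ge> N" for n
      using N[OF that] sup_dist_le_iff[OF \<sigma> \<open>a \<in> compl\<close>] by blast
    then show ?thesis
      using \<sigma> \<open>\<epsilon> > 0\<close> by (intro exI[of _ N]) force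
  qed
  ultimately have "limitin C.mtopology \<sigma> a sequentially"
    by (simp add: C.limit_metric_sequentially)
  then show "\<exists>a. limitin C.mtopology \<sigma> a sequentially"
    by blast
qed

section \<open>The shift on the completion and its inverse\<close>

lemma shift_embed: "x \<in> F \<Longrightarrow> shift (embed (T x)) = embed x"
  by (simp add: shift_def embed_def isometry u_in)

text \<open>The shift is known explicitly only at embedded points of the form \<open>T w\<close>;
  these are dense because late orbit points have predecessors.\<close>

lemma approx:
  assumes "a \<in> compl" "\<epsilon> > 0"
  obtains w where "w \<in> F" "sup_dist a (embed (T w)) < \<epsilon>"
proof -
  obtain n where n: "n \<ge> 1" "sup_dist a (embed (u n)) < \<epsilon>"
    using embed_dense[OF assms] by blast
  then obtain m where "n = Suc m"
    by (cases n) auto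
  then show ?thesis
    using that[of "u m"] u_in n by simp
qed

lemma shift_in:
  assumes "a \<in> compl"
  shows "shift a \<in> compl"
  unfolding compl_def
proof (intro CollectI strip)
  fix \<epsilon> :: real assume "\<epsilon> > 0"
  then obtain w where w: "w \<in> F" "sup_dist a (embed (T w)) < \<epsilon>"
    using approx[OF assms] by blast
  have "\<bar>shift a k - embed w k\<bar> \<le> \<epsilon>" for k
    using sup_dist_ge[OF assms embed_in[OF T_in[OF w(1)]], of "Suc k"] w(2) fun_cong[OF shift_embed[OF w(1)], of k]
    unfolding shift_def by linarith
  then show "\<exists>x\<in>F. \<forall>k. \<bar>shift a k - embed x k\<bar> \<le> \<epsilon>"
    using w(1) by blast
qed

text \<open>Dropping a coordinate cannot increase a supremum. That it does not decrease is checked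
  on the dense set of points \<open>embed (T w)\<close>, where \<open>T\<close> is an isometry; the
  four approximations account for \<open>\<epsilon> / 4\<close>.\<close>

lemma shift_isometry:
  assumes a: "a \<in> compl" and b: "b \<in> compl"
  shows "sup_dist (shift a) (shift b) = sup_dist a b"
proof (rule antisym)
  have le: "sup_dist (shift a) (shift b) \<le> sup_dist a b" if "a \<in> compl" "b \<in> compl" for a b
    using sup_dist_ge[OF that] that shift_in by (simp add: sup_dist_le_iff shift_def)
  then show "sup_dist (shift a) (shift b) \<le> sup_dist a b"
    using a b .
  show "sup_dist a b \<le> sup_dist (shift a) (shift b)"
  proof (rule field_le_epsilon)
    fix \<epsilon> :: real assume "\<epsilon> > 0"
    then have pos: "\<epsilon> / 4 > 0"
      by simp
    obtain v where v: "v \<in> F" "sup_dist a (embed (T v)) < \<epsilon> / 4"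
      using approx[OF a pos] by blast
    obtain w where w: "w \<in> F" "sup_dist b (embed (T w)) < \<epsilon> / 4"
      using approx[OF b pos] by blast
    have in': "embed (T v) \<in> compl" "embed (T w) \<in> compl" "embed v \<in> compl" "embed w \<in> compl"
      "shift a \<in> compl" "shift b \<in> compl"
      using v w T_in embed_in shift_in a b by auto
    have "sup_dist (shift a) (embed v) < \<epsilon> / 4" "sup_dist (shift b) (embed w) < \<epsilon> / 4"
      using le[OF a in'(1)] le[OF b in'(2)] v w shift_embed by auto
    moreover have "sup_dist (embed (T v)) (embed (T w)) = sup_dist (embed v) (embed w)"
      using v w T_in isometry by (simp add: sup_dist_embed)
    moreover have "sup_dist a b \<le> sup_dist a (embed (T v)) + sup_dist (embed (T v)) b"
      "sup_dist (embed (T v)) b \<le> sup_dist (embed (T v)) (embed (T w)) + sup_dist (embed (T w)) b"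
      "sup_dist (embed v) (embed w) \<le> sup_dist (embed v) (shift a) + sup_dist (shift a) (embed w)"
      "sup_dist (shift a) (embed w) \<le> sup_dist (shift a) (shift b) + sup_dist (shift b) (embed w)"
      using in' a b by (auto intro!: C.triangle)
    ultimately show "sup_dist a b \<le> sup_dist (shift a) (shift b) + \<epsilon>"
      using v(2) w(2) C.commute[of "embed v" "shift a"] C.commute[of "embed (T w)" b] by linarith
  qed
qed

text \<open>If \<open>embed (w n)\<close> converges to \<open>b\<close>, then
  \<open>embed (T (w n))\<close> is again Cauchy, since \<open>T\<close> preserves distances. Its
  limit is the required preimage.\<close>

lemma shift_surj:
  assumes b: "b \<in> compl"
  shows "\<exists>a\<in>compl. shift a = b"
proof -
  have "\<exists>x. x \<in> F \<and> sup_dist b (embed x) < inverse (Suc n)" for n :: nat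
    using embed_dense[OF b, of "inverse (Suc n)"] u_in by (metis inverse_positive_iff_positive of_nat_0_less_iff zero_less_Suc)
  then obtain w where w: "\<And>n. w n \<in> F" "\<And>n. sup_dist b (embed (w n)) < inverse (Suc n)"
    by metis
  define \<sigma> where "\<sigma> n = embed (T (w n))" for n
  have \<sigma>: "\<sigma> n \<in> compl" for n
    using w T_in embed_in by (simp add: \<sigma>_def)
  have "C.MCauchy \<sigma>"
    unfolding C.MCauchy_def
  proof (intro conjI strip)
    show "range \<sigma> \<subseteq> compl"
      using \<sigma> by auto
    fix \<epsilon> :: real assume "\<epsilon> > 0"
    then obtain N where N: "inverse (Suc N) < \<epsilon> / 2"
      using reals_Archimedean[of "\<epsilon> / 2"] by auto
    have small: "sup_dist b (embed (w n)) < \<epsilon> / 2" if "N \<le> n" for n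
    proof -
      have "inverse (real (Suc n)) \<le> inverse (real (Suc N))"
        using that by (intro le_imp_inverse_le) auto
      then show ?thesis
        using w(2)[of n] N by linarith
    qed
    have "sup_dist (\<sigma> n) (\<sigma> n') < \<epsilon>" if "N \<le> n" "N \<le> n'" for n n'
    proof -
      have "sup_dist (\<sigma> n) (\<sigma> n') = sup_dist (embed (w n)) (embed (w n'))"
        using w(1) T_in by (simp add: \<sigma>_def sup_dist_embed isometry)
      also have "\<dots> \<le> sup_dist (embed (w n)) b + sup_dist b (embed (w n'))"
        using w(1) b embed_in by (intro C.triangle) auto
      finally show ?thesis
        using small[OF that(1)] small[OF that(2)] C.commute[of b "embed (w n)"] by linarith
    qed
    then show "\<exists>N. \<forall>n n'. N \<le> n \<longrightarrow> N \<le> n' \<longrightarrow> sup_dist (\<sigma> n) (\<sigma> n') < \<epsilon>"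
      by blast
  qed
  then obtain a where "limitin C.mtopology \<sigma> a sequentially"
    using mcomplete_compl C.mcomplete_def by blast
  then have a: "a \<in> compl" and lim: "\<And>\<epsilon>. \<epsilon> > 0 \<Longrightarrow> \<exists>N. \<forall>n\<ge>N. \<sigma> n \<in> compl \<and> sup_dist (\<sigma> n) a < \<epsilon>"
    unfolding C.limit_metric_sequentially by auto
  have "sup_dist (shift a) b \<le> 0 + \<epsilon>" if "\<epsilon> > 0" for \<epsilon>
  proof -
    obtain N where N: "\<And>n. n \<ge> N \<Longrightarrow> sup_dist (\<sigma> n) a < \<epsilon> / 2"
      using lim[of "\<epsilon> / 2"] \<open>\<epsilon> > 0\<close> by auto
    obtain N' where N': "inverse (Suc N') < \<epsilon> / 2"
      using reals_Archimedean[of "\<epsilon> / 2"] \<open>\<epsilon> > 0\<close> by auto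
    define n where "n = max N N'"
    have "inverse (real (Suc n)) \<le> inverse (real (Suc N'))"
      by (intro le_imp_inverse_le) (auto simp: n_def)
    then have "sup_dist b (embed (w n)) < \<epsilon> / 2"
      using w(2)[of n] N' by linarith
    moreover have "sup_dist (embed (w n)) (shift a) = sup_dist (\<sigma> n) a"
      using shift_isometry[OF \<sigma> a, of n] shift_embed[OF w(1)] by (simp add: \<sigma>_def)
    moreover have "sup_dist (\<sigma> n) a < \<epsilon> / 2"
      by (rule N) (simp add: n_def)
    moreover have "sup_dist (shift a) b \<le> sup_dist (shift a) (embed (w n)) + sup_dist (embed (w n)) b"
      using shift_in a b w(1) embed_in by (intro C.triangle) auto
    ultimately show ?thesis
      using C.commute[of b "embed (w n)"] C.commute[of "shift a" "embed (w n)"] by linarith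
  qed
  then have "sup_dist (shift a) b \<le> 0"
    by (rule field_le_epsilon)
  then have "shift a = b"
    using C.nonneg[of "shift a" b] shift_in a b C.zero by (metis order_antisym)
  then show ?thesis
    using a by blast
qed

lemma bij_shift: "bij_betw shift compl compl"
proof (rule bij_betw_imageI)
  show "inj_on shift compl"
    by (rule inj_onI) (metis C.zero shift_in shift_isometry)
  show "shift ` compl = compl"
    using shift_in shift_surj by blast
qed

lemma bij_ext: "bij_betw ext compl compl"
  unfolding ext_def by (rule bij_betw_inv_into[OF bij_shift])

lemma ext_in: "a \<in> compl \<Longrightarrow> ext a \<in> compl"
  using bij_ext bij_betwE by blast

lemma shift_ext: "a \<in> compl \<Longrightarrow> shift (ext a) = a"
  unfolding ext_def by (rule bij_betw_inv_into_right[OF bij_shift])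

lemma ext_isometry: "a \<in> compl \<Longrightarrow> b \<in> compl \<Longrightarrow> sup_dist (ext a) (ext b) = sup_dist a b"
  using shift_isometry[OF ext_in ext_in] shift_ext by simp

lemma ext_embed: "x \<in> F \<Longrightarrow> ext (embed x) = embed (T x)"
  using bij_betw_inv_into_left[OF bij_shift embed_in[OF T_in]] shift_embed unfolding ext_def by simp

lemma ext_pow_in: "a \<in> compl \<Longrightarrow> (ext ^^ n) a \<in> compl"
  by (induction n) (auto simp: ext_in)

lemma ext_pow_isometry:
  "a \<in> compl \<Longrightarrow> b \<in> compl \<Longrightarrow> sup_dist ((ext ^^ n) a) ((ext ^^ n) b) = sup_dist a b"
  by (induction n) (auto simp: ext_isometry ext_pow_in)

lemma ext_pow_embed: "x \<in> F \<Longrightarrow> (ext ^^ n) (embed x) = embed ((T ^^ n) x)"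
  by (induction n) (auto simp: ext_embed pow_in)

section \<open>Rigidity and minimality of the extension\<close>

lemma bijective_isometry_ext: "bijective_isometry compl sup_dist ext"
  unfolding bijective_isometry_def using bij_ext ext_isometry by blast

lemma ext_rigid:
  assumes "\<epsilon> > 0"
  shows "\<exists>n\<ge>k. \<forall>a\<in>compl. sup_dist ((ext ^^ n) a) a < \<epsilon>"
proof -
  obtain n where n: "n \<ge> k" "\<forall>x\<in>F. d ((T ^^ n) x) x < \<epsilon> / 3"
    using rigid[of "\<epsilon> / 3" k] assms by auto
  have "sup_dist ((ext ^^ n) a) a < \<epsilon>" if a: "a \<in> compl" for a
  proof -
    obtain m where m: "sup_dist a (embed (u m)) < \<epsilon> / 3"
      using embed_dense[OF a, of "\<epsilon> / 3"] assms by auto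
    let ?x = "embed (u m)"
    have x: "?x \<in> compl"
      by (simp add: u_in embed_in)
    have "sup_dist ((ext ^^ n) ?x) ?x = d ((T ^^ n) (u m)) (u m)"
      using sup_dist_embed pow_in u_in ext_pow_embed by simp
    then have "sup_dist ((ext ^^ n) ?x) ?x < \<epsilon> / 3"
      using n(2) u_in by simp
    moreover have "sup_dist ((ext ^^ n) a) ((ext ^^ n) ?x) < \<epsilon> / 3"
      using m ext_pow_isometry[OF a x] by simp
    moreover have "sup_dist ((ext ^^ n) a) a \<le> sup_dist ((ext ^^ n) a) ((ext ^^ n) ?x) + sup_dist ((ext ^^ n) ?x) a"
      "sup_dist ((ext ^^ n) ?x) a \<le> sup_dist ((ext ^^ n) ?x) ?x + sup_dist ?x a"
      using a x ext_pow_in by (auto intro!: C.triangle)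
    ultimately show ?thesis
      using m C.commute[of a ?x] by linarith
  qed
  then show ?thesis
    using n by blast
qed

lemma uniformly_rigid_ext: "uniformly_rigid compl sup_dist ext"
proof -
  have "\<exists>n\<ge>i. \<forall>a\<in>compl. sup_dist ((ext ^^ n) a) a < inverse (Suc i)" for i
    using ext_rigid[of "inverse (Suc i)" i] by simp
  then obtain n where n: "\<And>i. n i \<ge> i" "\<And>i a. a \<in> compl \<Longrightarrow> sup_dist ((ext ^^ n i) a) a < inverse (Suc i)"
    by metis
  have "filterlim n at_top sequentially"
    using n(1) by (intro filterlim_at_top_mono[OF filterlim_ident]) auto
  moreover have "uniform_limit compl (\<lambda>i a. sup_dist ((ext ^^ n i) a) a) (\<lambda>_. 0) sequentially"
  proof (rule uniform_limitI)
    fix \<epsilon> :: real assume "\<epsilon> > 0"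
    have "eventually (\<lambda>i. inverse (real (Suc i)) < \<epsilon>) sequentially"
      using order_tendstoD(2)[OF LIMSEQ_inverse_real_of_nat \<open>\<epsilon> > 0\<close>] .
    then show "\<forall>\<^sub>F i in sequentially. \<forall>a\<in>compl. dist (sup_dist ((ext ^^ n i) a) a) 0 < \<epsilon>"
    proof eventually_elim
      case (elim i)
      then show ?case
        using n(2)[of _ i] by (auto intro: order.strict_trans)
    qed
  qed
  ultimately show ?thesis
    unfolding uniformly_rigid_def by blast
qed

text \<open>Choose an orbit point of \<open>z\<close> near \<open>b\<close> and a later one near
  \<open>a\<close>. The power of \<open>ext\<close> that carries the first to the second is an
  isometry, so it carries \<open>b\<close> close to \<open>a\<close>.\<close>

lemma ext_orbit_dense:
  assumes a: "a \<in> compl" and b: "b \<in> compl" and "\<epsilon> > 0"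
  shows "\<exists>n. sup_dist a ((ext ^^ n) b) < \<epsilon>"
proof -
  have pos: "\<epsilon> / 2 > 0"
    using assms by simp
  obtain m where m: "sup_dist b (embed (u m)) < \<epsilon> / 2"
    using embed_dense[OF b pos] by blast
  obtain k where k: "k \<ge> m" "sup_dist a (embed (u k)) < \<epsilon> / 2"
    using embed_dense[OF a pos] by blast
  define n where "n = k - m"
  have "embed (u k) = (ext ^^ n) (embed (u m))"
    using k(1) ext_pow_embed[OF u_in[of m], of n] by (simp add: n_def flip: funpow_add comp_apply[of "T ^^ _" "T ^^ _"])
  then have "sup_dist (embed (u k)) ((ext ^^ n) b) = sup_dist (embed (u m)) b"
    using ext_pow_isometry b u_in embed_in by simp
  moreover have "sup_dist a ((ext ^^ n) b) \<le> sup_dist a (embed (u k)) + sup_dist (embed (u k)) ((ext ^^ n) b)"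
    using a b u_in embed_in ext_pow_in by (intro C.triangle) auto
  ultimately have "sup_dist a ((ext ^^ n) b) < \<epsilon>"
    using m k(2) C.commute[of b "embed (u m)"] by linarith
  then show ?thesis ..
qed

lemma compl_not_isolated:
  assumes a: "a \<in> compl" and "\<epsilon> > 0"
  shows "\<exists>b\<in>compl. b \<noteq> a \<and> sup_dist a b < \<epsilon>"
proof -
  obtain n where n: "sup_dist a (embed (u n)) < \<epsilon>"
    using embed_dense[OF assms] by blast
  show ?thesis
  proof (cases "embed (u n) = a")
    case True
    obtain y where "y \<in> F" "y \<noteq> u n" "d (u n) y < \<epsilon>"
      using not_isolated[OF u_in \<open>\<epsilon> > 0\<close>] by blast
    then have "embed y \<noteq> a" "sup_dist a (embed y) < \<epsilon>"
      using True inj_embed u_in sup_dist_embed[OF u_in[of n], of y] by (auto simp: inj_on_def)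
    then show ?thesis
      using embed_in[OF \<open>y \<in> F\<close>] by blast
  next
    case False
    then show ?thesis
      using n u_in embed_in by blast
  qed
qed

text \<open>An accumulation point needs orbit points other than itself. So the orbit is steered
  towards a nearby \<open>a'\<close> different from \<open>a\<close>, and closer to
  \<open>a'\<close> than \<open>a\<close> is.\<close>

lemma minimal_ext: "minimal_map compl sup_dist ext"
  unfolding minimal_map_def omega_limit_def
proof (intro ballI)
  fix b assume b: "b \<in> compl"
  have "\<exists>c\<in>{(ext ^^ n) b |n. True}. c \<noteq> a \<and> c \<in> C.mball a r" if a: "a \<in> compl" and "r > 0" for a r
  proof -
    obtain a' where a': "a' \<in> compl" "a' \<noteq> a" "sup_dist a a' < r / 2"
      using compl_not_isolated[OF a, of "r / 2"] \<open>r > 0\<close> by auto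
    then have "sup_dist a a' > 0"
      using a C.mdist_pos_eq by metis
    then obtain n where n: "sup_dist a' ((ext ^^ n) b) < min (r / 2) (sup_dist a a')"
      using ext_orbit_dense[OF a'(1) b, of "min (r / 2) (sup_dist a a')"] \<open>r > 0\<close> by auto
    have "(ext ^^ n) b \<noteq> a"
      using n C.commute[of a a'] by auto
    moreover have "sup_dist a ((ext ^^ n) b) \<le> sup_dist a a' + sup_dist a' ((ext ^^ n) b)"
      using a a' b ext_pow_in by (intro C.triangle) auto
    then have "(ext ^^ n) b \<in> C.mball a r"
      using n a' a b ext_pow_in by simp
    ultimately show ?thesis
      by blast
  qed
  then show "C.mtopology derived_set_of {(ext ^^ n) b |n. True} = compl"
    unfolding C.metric_derived_set_of by blast
qed

lemma separable_compl: "separable_space C.mtopology"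
  unfolding separable_space_def
proof (intro exI[of _ "range (\<lambda>n. embed (u n))"] conjI)
  show "range (\<lambda>n. embed (u n)) \<subseteq> topspace C.mtopology"
    using u_in embed_in by auto
  have "\<exists>b\<in>range (\<lambda>n. embed (u n)). b \<in> C.mball a r" if "a \<in> compl" "r > 0" for a r
    using embed_dense[OF that, of 0] that u_in embed_in by auto
  then show "C.mtopology closure_of range (\<lambda>n. embed (u n)) = topspace C.mtopology"
    unfolding C.metric_closure_of by auto
qed simp


text \<open>Balls of radius 1/(m+1) about orbit points form a countable base, so measurability of
  the distances to the orbit is enough.\<close>

lemma embed_vimage_sets:
  assumes d: "\<And>n r. {x \<in> F. d x (u n) < r} \<in> sets N" and U: "openin C.mtopology U"
  shows "embed -` U \<inter> F \<in> sets N"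
proof -
  define I where "I = {(n, m). C.mball (embed (u n)) (inverse (Suc m)) \<subseteq> U}"
  have "\<exists>p\<in>I. d x (u (fst p)) < inverse (Suc (snd p))" if x: "x \<in> F" "embed x \<in> U" for x
  proof -
    obtain r where r: "r > 0" "C.mball (embed x) r \<subseteq> U"
      using U x(2) unfolding C.openin_mtopology by blast
    obtain m where m: "inverse (Suc m) < r / 2"
      using reals_Archimedean[of "r / 2"] r by auto
    obtain n where n: "d x (u n) < inverse (Suc m)"
      using recurrent[OF x(1), of "inverse (Suc m)" 0] by auto
    have "sup_dist (embed x) (embed (u n)) < inverse (Suc m)"
      using n sup_dist_embed[OF x(1) u_in] by simp
    then have "sup_dist (embed x) a < r"
      if "a \<in> compl" "sup_dist (embed (u n)) a < inverse (Suc m)" for a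
      using C.triangle[OF embed_in[OF x(1)] embed_in[OF u_in[of n]] that(1)] that(2) m by linarith
    then have "C.mball (embed (u n)) (inverse (Suc m)) \<subseteq> C.mball (embed x) r"
      using embed_in[OF x(1)] by auto
    then have "(n, m) \<in> I"
      using r(2) unfolding I_def by blast
    then show ?thesis
      using n by (intro bexI[of _ "(n, m)"]) auto
  qed
  moreover have "embed x \<in> U" if "x \<in> F" "p \<in> I" "d x (u (fst p)) < inverse (Suc (snd p))" for x p
  proof -
    obtain n m where [simp]: "p = (n, m)"
      by force
    have "embed x \<in> C.mball (embed (u n)) (inverse (Suc m))"
      using that(1,3) u_in embed_in sup_dist_embed[OF u_in that(1), of n] by (simp add: commute)
    moreover have "C.mball (embed (u n)) (inverse (Suc m)) \<subseteq> U"
      using that(2) unfolding I_def by simp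
    ultimately show ?thesis
      by blast
  qed
  ultimately have "embed -` U \<inter> F = (\<Union>p\<in>I. {x \<in> F. d x (u (fst p)) < inverse (Suc (snd p))})"
    by blast
  also have "\<dots> \<in> sets N"
    by (intro sets.countable_UN') (auto simp: d)
  finally show ?thesis .
qed

lemma continuous_ext: "continuous_map C.mtopology C.mtopology ext"
  unfolding continuous_map_def
proof (intro conjI strip)
  fix U assume U: "openin C.mtopology U"
  show "openin C.mtopology {a \<in> topspace C.mtopology. ext a \<in> U}"
    unfolding C.openin_mtopology
  proof (intro conjI strip)
    fix a assume "a \<in> {a \<in> topspace C.mtopology. ext a \<in> U}"
    then have a: "a \<in> compl" "ext a \<in> U"
      by auto
    obtain r where r: "r > 0" "C.mball (ext a) r \<subseteq> U"
      using U a(2) unfolding C.openin_mtopology by blast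
    have "C.mball a r \<subseteq> {a \<in> topspace C.mtopology. ext a \<in> U}"
      using r(2) ext_isometry[OF a(1)] ext_in by auto
    then show "\<exists>r>0. C.mball a r \<subseteq> {a \<in> topspace C.mtopology. ext a \<in> U}"
      using r(1) by blast
  qed auto
qed (auto simp: ext_in)

end

lemma (in Metric_space) separable_imp_second_countable:
  assumes "separable_space mtopology"
  shows "second_countable mtopology"
proof -
  obtain Q where Q: "countable Q" "Q \<subseteq> M" "mtopology closure_of Q = M"
    using assms unfolding separable_space_def by auto
  define \<B> where "\<B> = (\<lambda>(q, m). mball q (inverse (Suc m))) ` (Q \<times> (UNIV :: nat set))"
  have "\<exists>V\<in>\<B>. x \<in> V \<and> V \<subseteq> U" if U: "openin mtopology U" "x \<in> U" for U x
  proof -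
    obtain r where r: "r > 0" "mball x r \<subseteq> U"
      using U unfolding openin_mtopology by blast
    obtain m where m: "inverse (Suc m) < r / 2"
      using reals_Archimedean[of "r / 2"] r by auto
    have x: "x \<in> M"
      using U openin_mtopology by blast
    then have "x \<in> mtopology closure_of Q"
      using Q by simp
    moreover have "inverse (Suc m) > 0"
      by simp
    ultimately obtain q where q: "q \<in> Q" "q \<in> mball x (inverse (Suc m))"
      unfolding metric_closure_of by blast
    then have "q \<in> M" "d x q < inverse (Suc m)"
      by auto
    then have "mball q (inverse (Suc m)) \<subseteq> mball x r"
      using x m triangle[OF x \<open>q \<in> M\<close>] by fastforce
    moreover have "x \<in> mball q (inverse (Suc m))"
      using q x by (simp add: commute)
    moreover have "mball q (inverse (Suc m)) \<in> \<B>"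
      using q(1) unfolding \<B>_def by force
    ultimately show ?thesis
      using r(2) by blast
  qed
  moreover have "countable \<B>"
    unfolding \<B>_def using Q(1) by (intro countable_image countable_SIGMA) auto
  moreover have "openin mtopology V" if "V \<in> \<B>" for V
    using that unfolding \<B>_def by auto
  ultimately show ?thesis
    unfolding second_countable_def by (intro exI[of _ \<B>]) blast
qed

subsection \<open>Embedding a nonsingular system into a Polish space\<close>

context nonsingular_system
begin

lemma pow_measurable [measurable]: "T ^^ n \<in> measurable M M"
proof (induction n)
  case 0
  show ?case
    by (simp add: id_def)
next
  case (Suc n)
  then show ?case
    using measurable_comp[OF Suc measurable_map] by (simp only: funpow.simps)
qed

lemma pow_in_space: "x \<in> space M \<Longrightarrow> (T ^^ n) x \<in> space M"
  using measurable_space[OF pow_measurable] .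

lemma emeasure_pow_vimage_eq_0_iff:
  "A \<in> sets M \<Longrightarrow> emeasure M ((T ^^ n) -` A \<inter> space M) = 0 \<longleftrightarrow> emeasure M A = 0"
proof (induction n)
  case 0
  then show ?case
    using sets.sets_into_space[OF 0] by (simp add: Int_absorb2)
next
  case (Suc n)
  have "(T ^^ Suc n) -` A \<inter> space M = T -` ((T ^^ n) -` A \<inter> space M) \<inter> space M"
    using measurable_space[OF measurable_map] by (auto simp: funpow_swap1)
  moreover have "(T ^^ n) -` A \<inter> space M \<in> sets M"
    using measurable_sets[OF pow_measurable Suc.prems] .
  ultimately show ?case
    using nonsingular Suc by metis
qed

text \<open>
  Null sets may prevent the embedding from having a Borel image; passing to the points whose whole
  forward orbit avoids them leaves an invariant conull set on which it is bimeasurable.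
\<close>

lemma isomorphic_mod0_embedding:
  assumes Y: "completely_metrizable_space Y" "separable_space Y" "second_countable Y"
    and S: "continuous_map Y Y S"
    and F: "F \<in> sets M" "emeasure M (space M - F) = 0"
    and e: "e ` F \<subseteq> topspace Y" "inj_on e F" "\<And>U. openin Y U \<Longrightarrow> e -` U \<inter> F \<in> sets M"
    and comm: "\<And>x. x \<in> F \<Longrightarrow> e (T x) = S (e x)"
  obtains N where "space N = topspace Y" "sets N = borel_sets_of Y" "nonsingular_system N S"
    "isomorphic_mod0 M T N S"
proof -
  have Haus: "Hausdorff_space Y"
    using Y(1) completely_metrizable_imp_metrizable_space metrizable_imp_Hausdorff_space by blast
  obtain V where V: "V \<in> sets M" "V \<subseteq> F" "emeasure M (F - V) = 0"
    and V_image: "\<And>A. A \<in> sets M \<Longrightarrow> A \<subseteq> V \<Longrightarrow> e ` A \<in> borel_sets_of Y"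
    using injective_borel_image_mod0[OF standard_borel Y(3) Haus F(1) e] by auto
  have "space M - F \<union> (F - V) \<in> null_sets M"
    using F V by (intro null_sets.Un) auto
  moreover have "space M - F \<union> (F - V) = space M - V"
    using V(2) sets.sets_into_space[OF F(1)] by blast
  ultimately have V_null: "emeasure M (space M - V) = 0"
    by auto
  define W where "W = (\<Inter>n. (T ^^ n) -` V \<inter> space M)"
  have W: "W \<in> sets M"
    unfolding W_def using measurable_sets[OF pow_measurable V(1)] by (intro sets.countable_INT') auto
  have W_space: "W \<subseteq> space M"
    by (rule sets.sets_into_space[OF W])
  have WV: "W \<subseteq> V"
  proof
    fix x assume "x \<in> W"
    then have "(T ^^ 0) x \<in> V"
      unfolding W_def by blast
    then show "x \<in> V"
      by simp
  qed
  have WF: "W \<subseteq> F"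
    using WV V(2) by blast
  have TW: "T x \<in> W" if "x \<in> W" for x
  proof -
    have "(T ^^ n) (T x) \<in> V" for n
    proof -
      have "(T ^^ Suc n) x \<in> V"
        using that unfolding W_def by blast
      then show ?thesis
        by (simp add: funpow_swap1)
    qed
    moreover have "T x \<in> space M"
      using that W_space measurable_space[OF measurable_map] by blast
    ultimately show ?thesis
      by (simp add: W_def)
  qed
  have "(T ^^ n) -` (space M - V) \<inter> space M \<in> null_sets M" for n
    using emeasure_pow_vimage_eq_0_iff[of "space M - V" n] V(1) V_null
      measurable_sets[OF pow_measurable, of "space M - V" n] by auto
  then have "(\<Union>n. (T ^^ n) -` (space M - V) \<inter> space M) \<in> null_sets M"
    by (intro null_sets_UN) auto
  moreover have "space M - W = (\<Union>n. (T ^^ n) -` (space M - V) \<inter> space M)"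
    using pow_in_space by (auto simp: W_def)
  ultimately have W_null: "space M - W \<in> null_sets M"
    by simp
  have emeasure_Int_W: "emeasure M (A \<inter> W) = emeasure M A" if "A \<in> sets M" for A
  proof (rule emeasure_eq_AE)
    show "AE x in M. x \<in> A \<inter> W \<longleftrightarrow> x \<in> A"
      using AE_not_in[OF W_null] AE_space by eventually_elim auto
  qed (use W that in auto)
  define B where "B = sigma (topspace Y) {U. openin Y U}"
  have B: "space B = topspace Y" "sets B = borel_sets_of Y"
    using openin_subset[of Y] by (auto simp: B_def borel_sets_of_def space_measure_of_conv sets_measure_of_conv)
  have eM: "e \<in> measurable (restrict_space M W) B"
    unfolding B_def
  proof (rule measurable_measure_of)
    fix U assume "U \<in> {U. openin Y U}"
    then have "e -` U \<inter> F \<inter> W \<in> sets M"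
      using e(3) W by auto
    moreover have "e -` U \<inter> F \<inter> W = e -` U \<inter> space (restrict_space M W)"
      using WF W_space by (auto simp: space_restrict_space)
    ultimately show "e -` U \<inter> space (restrict_space M W) \<in> sets (restrict_space M W)"
      using W by (auto simp: sets_restrict_space_iff)
  qed (use openin_subset[of Y] e(1) WF in \<open>auto simp: space_restrict_space\<close>)
  \<comment> \<open>Only the part of \<open>M\<close> on \<open>W\<close> is transported. The image
    of \<open>W\<close> then has full measure by construction, and nothing is lost because the rest
    of \<open>M\<close> is null.\<close>
  define N where "N = distr (restrict_space M W) B e"
  have N: "space N = topspace Y" "sets N = borel_sets_of Y"
    by (simp_all add: N_def B)
  have vim: "e -` A \<inter> W \<in> sets M" if "A \<in> sets N" for A
    using measurable_sets[OF eM, of A] that W W_space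
    by (simp add: N B space_restrict_space sets_restrict_space_iff Int_absorb2)
  have em: "emeasure N A = emeasure M (e -` A \<inter> W)" if "A \<in> sets N" for A
  proof -
    have "emeasure N A = emeasure (restrict_space M W) (e -` A \<inter> W)"
      using that eM W_space by (simp add: N_def emeasure_distr space_restrict_space Int_absorb2)
    then show ?thesis
      using W by (simp add: emeasure_restrict_space)
  qed
  have img: "e ` A \<in> sets N" if "A \<in> sets M" "A \<subseteq> W" for A
    unfolding N using that WV by (intro V_image) auto
  have vim_img: "e -` (e ` A) \<inter> W = A" if "A \<subseteq> W" for A
    using that WF inj_onD[OF e(2)] by blast
  have em_img: "emeasure N (e ` A) = emeasure M A" if "A \<in> sets M" "A \<subseteq> W" for A
    using em[OF img[OF that]] vim_img[OF that(2)] by simp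
  have N_null: "emeasure N (space N - e ` W) = 0"
  proof -
    have "e -` (space N - e ` W) \<inter> W = {}"
      by auto
    then show ?thesis
      using em[of "space N - e ` W"] img[OF W] by auto
  qed
  have SN: "S \<in> measurable N N"
  proof (rule measurable_sigma_sets[where A = "{U. openin Y U}" and \<Omega> = "topspace Y"])
    show "S \<in> space N \<rightarrow> topspace Y"
      using S by (auto simp: N continuous_map_def)
    fix U assume "U \<in> {U. openin Y U}"
    then have "openin Y {x \<in> topspace Y. S x \<in> U}"
      using S by (auto simp: continuous_map_def)
    moreover have "S -` U \<inter> space N = {x \<in> topspace Y. S x \<in> U}"
      by (auto simp: N)
    ultimately show "S -` U \<inter> space N \<in> sets N"
      unfolding N by (simp add: openin_borel_sets_of)
  qed (use openin_subset[of Y] in \<open>auto simp: N borel_sets_of_def\<close>)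
  have "nonsingular_system N S"
  proof (intro nonsingular_system.intro nonsingular_system_axioms.intro)
    obtain A :: "nat \<Rightarrow> 'a set" where A: "range A \<subseteq> sets M" "(\<Union>i. A i) = space M"
      "\<And>i. emeasure M (A i) \<noteq> \<infinity>"
      using sigma_finite by blast
    show "sigma_finite_measure N"
    proof (standard, intro exI conjI)
      \<comment> \<open>The images of the finite pieces cover only the image of \<open>W\<close>;
        its null complement completes the cover.\<close>
      let ?C = "insert (space N - e ` W) (range (\<lambda>i. e ` (A i \<inter> W)))"
      have AW: "A i \<inter> W \<in> sets M" for i
        using A W by auto
      show "countable ?C"
        by simp
      show "?C \<subseteq> sets N"
        using img[OF AW] img[OF W] by auto
      have "e ` W \<subseteq> space N"
        using e(1) WF N by auto
      moreover have "e ` W = (\<Union>i. e ` (A i \<inter> W))"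
        using A(2) W_space by blast
      ultimately show "\<Union> ?C = space N"
        by auto
      have "emeasure N (e ` (A i \<inter> W)) \<noteq> \<infinity>" for i
        using em_img[OF AW[of i]] emeasure_Int_W[of "A i"] A by auto
      then show "\<forall>a\<in>?C. emeasure N a \<noteq> \<infinity>"
        using N_null by auto
    qed
    show "standard_borel N"
      unfolding standard_borel_def using Y N by auto
    have "e -` space N \<inter> W = W"
      using e(1) WF by (auto simp: N)
    then have "emeasure N (space N) = emeasure M W"
      using em[of "space N"] by simp
    then show "emeasure N (space N) \<noteq> 0"
      using emeasure_Int_W[of "space M"] nonzero W_space by (simp add: Int_absorb1)
    show "nonatomic N"
      unfolding nonatomic_def
    proof (intro ballI impI)
      fix A assume A: "A \<in> sets N" "emeasure N A > 0"
      then obtain D where D: "D \<in> sets M" "D \<subseteq> e -` A \<inter> W" "0 < emeasure M D"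
        "emeasure M D < emeasure M (e -` A \<inter> W)"
        using nonatomic vim[OF A(1)] em[OF A(1)] unfolding nonatomic_def by metis
      then have "D \<subseteq> W"
        by blast
      then show "\<exists>D\<in>sets N. D \<subseteq> A \<and> 0 < emeasure N D \<and> emeasure N D < emeasure N A"
        using D em[OF A(1)] em_img[OF D(1)] img[OF D(1)] by (intro bexI[of _ "e ` D"]) auto
    qed
    show "S \<in> measurable N N"
      by (rule SN)
    fix A assume A: "A \<in> sets N"
    have SA: "S -` A \<inter> space N \<in> sets N"
      using measurable_sets[OF SN A] .
    \<comment> \<open>Preimages under \<open>S\<close> and \<open>T\<close> correspond only inside
      \<open>W\<close>; \<open>emeasure_Int_W\<close> then removes the intersection with
      \<open>W\<close>.\<close>
    have "e -` (S -` A \<inter> space N) \<inter> W = (T -` (e -` A \<inter> W) \<inter> space M) \<inter> W"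
      using TW W_space comm WF e(1) N by (auto simp: subset_iff)
    then have "emeasure N (S -` A \<inter> space N) = emeasure M (T -` (e -` A \<inter> W) \<inter> space M)"
      using em[OF SA] emeasure_Int_W measurable_sets[OF measurable_map vim[OF A]] by simp
    then show "emeasure N A = 0 \<longleftrightarrow> emeasure N (S -` A \<inter> space N) = 0"
      using em[OF A] nonsingular[OF vim[OF A]] by simp
  qed
  moreover have "isomorphic_mod0 M T N S"
    unfolding isomorphic_mod0_def
  proof (intro bexI[of _ W] bexI[of _ "e ` W"] exI[of _ e] conjI)
    show "emeasure M (space M - W) = 0"
      using W_null by auto
    show "T ` W \<subseteq> W"
      using TW by blast
    show "S ` e ` W \<subseteq> e ` W"
    proof safe
      fix x assume "x \<in> W"
      then have "S (e x) = e (T x)" "T x \<in> W"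
        using comm WF TW by auto
      then show "S (e x) \<in> e ` W"
        by simp
    qed
    show bij: "bij_betw e W (e ` W)"
      using inj_on_subset[OF e(2) WF] by (rule inj_on_imp_bij_betw)
    have "e \<in> measurable (restrict_space M W) N"
      using eM by (simp add: N_def)
    then show "e \<in> measurable (restrict_space M W) (restrict_space N (e ` W))"
      by (intro measurable_restrict_space2) (auto simp: space_restrict_space)
    show "the_inv_into W e \<in> measurable (restrict_space N (e ` W)) (restrict_space M W)"
    proof (rule measurableI)
      show "the_inv_into W e y \<in> space (restrict_space M W)"
        if "y \<in> space (restrict_space N (e ` W))" for y
        using that bij_betwE[OF bij_betw_the_inv_into[OF bij]] W_space
        by (auto simp: space_restrict_space)
      fix A assume "A \<in> sets (restrict_space M W)"
      then have A: "A \<in> sets M" "A \<subseteq> W"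
        using W by (auto simp: sets_restrict_space_iff)
      have "the_inv_into W e (e x) = x" if "x \<in> W" for x
        using the_inv_into_f_f[OF bij_betw_imp_inj_on[OF bij] that] .
      then have "the_inv_into W e -` A \<inter> space (restrict_space N (e ` W)) = e ` A"
        using A(2) sets.sets_into_space[OF img[OF A]] by (auto simp: space_restrict_space)
      then show "the_inv_into W e -` A \<inter> space (restrict_space N (e ` W)) \<in> sets (restrict_space N (e ` W))"
        using img[OF A] img[OF W] A(2) by (auto simp: sets_restrict_space_iff)
    qed
    show "\<forall>A\<in>sets N. A \<subseteq> e ` W \<longrightarrow> emeasure M (e -` A \<inter> W) = emeasure N A"
      using em by simp
    show "\<forall>x\<in>W. e (T x) = S (e x)"
      using comm WF by blast
  qed (use N_null img[OF W] W in auto)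
  ultimately show ?thesis
    using that N by blast
qed

end

subsection \<open>Insensitive metrics\<close>

locale ergodic_system = nonsingular_system +
  assumes ergodic: "conservative_ergodic M T"
begin

text \<open>The complement of a forward invariant set contains its own preimage, which is the form
  that \<open>conservative_ergodic\<close> speaks about.\<close>

lemma conull_of_forward_invariant:
  assumes "F \<in> sets M" "\<And>x. x \<in> F \<Longrightarrow> T x \<in> F" "emeasure M F \<noteq> 0"
  shows "emeasure M (space M - F) = 0"
proof -
  have F: "F \<subseteq> space M"
    by (rule sets.sets_into_space[OF assms(1)])
  have "T -` (space M - F) \<inter> space M \<subseteq> space M - F"
    using assms(2) by blast
  then have "emeasure M (space M - F) = 0 \<or> emeasure M (space M - (space M - F)) = 0"
    using ergodic assms(1) unfolding conservative_ergodic_def by blast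
  then show ?thesis
    using assms(3) F by (simp add: double_diff)
qed

text \<open>The set of points that visit \<open>A\<close> at some time from \<open>k\<close> on
  contains its own preimage, since one more step only delays the visit. It is not null, as it
  contains the preimage of \<open>A\<close> under T^k.\<close>

lemma AE_visits_infinitely_often:
  assumes A: "A \<in> sets M" "emeasure M A \<noteq> 0"
  shows "AE x in M. \<exists>n\<ge>k. (T ^^ n) x \<in> A"
proof -
  define D where "D = {x \<in> space M. \<exists>n\<ge>k. (T ^^ n) x \<in> A}"
  have D: "D \<in> sets M"
  proof -
    have "D = (\<Union>n\<in>{k..}. (T ^^ n) -` A \<inter> space M)"
      by (auto simp: D_def)
    also have "\<dots> \<in> sets M"
      using measurable_sets[OF pow_measurable A(1)] by (intro sets.countable_UN') auto
    finally show ?thesis .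
  qed
  have "T -` D \<inter> space M \<subseteq> D"
  proof
    fix x assume "x \<in> T -` D \<inter> space M"
    then obtain n where "n \<ge> k" "(T ^^ n) (T x) \<in> A" "x \<in> space M"
      unfolding D_def by blast
    then show "x \<in> D"
      unfolding D_def by (auto simp: funpow_swap1 intro!: exI[of _ "Suc n"])
  qed
  moreover have "emeasure M D \<noteq> 0"
  proof
    assume "emeasure M D = 0"
    moreover have "(T ^^ k) -` A \<inter> space M \<subseteq> D"
      by (auto simp: D_def)
    ultimately have "emeasure M ((T ^^ k) -` A \<inter> space M) = 0"
      using D by (metis emeasure_eq_0)
    then show False
      using A emeasure_pow_vimage_eq_0_iff by blast
  qed
  ultimately have "emeasure M (space M - D) = 0"
    using ergodic D unfolding conservative_ergodic_def by blast
  then have "space M - D \<in> null_sets M"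
    using D by (intro null_setsI) auto
  then have "AE x in M. x \<notin> space M - D"
    by (rule AE_not_in)
  with AE_space show ?thesis
    by eventually_elim (simp add: D_def)
qed

end

lemma (in sigma_finite_measure) AE_imp_ex:
  assumes "AE x in M. P x" "emeasure M (space M) \<noteq> 0"
  shows "\<exists>x\<in>space M. P x"
proof (rule ccontr)
  assume "\<not> ?thesis"
  with assms(1) AE_space have "AE x in M. False"
    by (auto elim: eventually_elim2)
  then show False
    using assms(2) AE_iff_measurable[of "space M" M "\<lambda>_. False"] by simp
qed

locale insensitive_metric = ergodic_system +
  fixes d :: "'a \<Rightarrow> 'a \<Rightarrow> real"
  assumes compatible: "compatible_metric M d"
    and insensitive: "\<not> W_measurably_sensitive_wrt M T d"
begin

sublocale d: Metric_space "space M" d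
  using compatible by (simp add: compatible_metric_def)

section \<open>The orbit metric\<close>

lemma d_le_1: "x \<in> space M \<Longrightarrow> y \<in> space M \<Longrightarrow> d x y \<le> 1"
  using compatible by (simp add: compatible_metric_def)

text \<open>The term n = 0 makes it dominate \<open>d\<close>, so that it separates points; the
  bound 1 on \<open>d\<close> keeps the supremum finite.\<close>

definition orbit_dist :: "'a \<Rightarrow> 'a \<Rightarrow> real" where
  "orbit_dist x y =
    (if x \<in> space M \<and> y \<in> space M then SUP n. d ((T ^^ n) x) ((T ^^ n) y) else 0)"

lemma orbit_dist_le_iff:
  assumes "x \<in> space M" "y \<in> space M"
  shows "orbit_dist x y \<le> r \<longleftrightarrow> (\<forall>n. d ((T ^^ n) x) ((T ^^ n) y) \<le> r)"
proof -
  have "bdd_above (range (\<lambda>n. d ((T ^^ n) x) ((T ^^ n) y)))"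
    using assms pow_in_space d_le_1 by (intro bdd_aboveI[of _ 1]) auto
  then show ?thesis
    using assms by (simp add: orbit_dist_def cSUP_le_iff)
qed

lemma orbit_dist_ge:
  assumes "x \<in> space M" "y \<in> space M"
  shows "d ((T ^^ n) x) ((T ^^ n) y) \<le> orbit_dist x y"
  using orbit_dist_le_iff[OF assms] by blast

sublocale o: Metric_space "space M" orbit_dist
proof
  show nn: "0 \<le> orbit_dist x y" for x y
  proof (cases "x \<in> space M \<and> y \<in> space M")
    case True
    then show ?thesis
      using order_trans[OF d.nonneg orbit_dist_ge[of x y 0]] by simp
  qed (auto simp: orbit_dist_def)
  show "orbit_dist x y = orbit_dist y x" for x y
    by (simp add: orbit_dist_def d.commute)
  show "orbit_dist x y = 0 \<longleftrightarrow> x = y" if "x \<in> space M" "y \<in> space M" for x y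
  proof
    assume "orbit_dist x y = 0"
    then have "d x y = 0"
      using orbit_dist_ge[OF that, of 0] d.nonneg[of x y] by simp
    then show "x = y"
      using that by simp
  next
    assume "x = y"
    then have "orbit_dist x y \<le> 0"
      using that pow_in_space by (simp add: orbit_dist_le_iff)
    then show "orbit_dist x y = 0"
      using nn[of x y] by simp
  qed
  show "orbit_dist x w \<le> orbit_dist x y + orbit_dist y w"
    if "x \<in> space M" "y \<in> space M" "w \<in> space M" for x y w
  proof -
    have "d ((T ^^ n) x) ((T ^^ n) w) \<le> orbit_dist x y + orbit_dist y w" for n
      using d.triangle[of "(T ^^ n) x" "(T ^^ n) y" "(T ^^ n) w"] that pow_in_space
        orbit_dist_ge[of x y n] orbit_dist_ge[of y w n] by auto
    then show ?thesis
      using that by (simp add: orbit_dist_le_iff)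
  qed
qed

lemma T_in_space: "x \<in> space M \<Longrightarrow> T x \<in> space M"
  using measurable_space[OF measurable_map] .

lemma orbit_dist_contraction:
  assumes "x \<in> space M" "y \<in> space M"
  shows "orbit_dist (T x) (T y) \<le> orbit_dist x y"
proof -
  have "d ((T ^^ n) (T x)) ((T ^^ n) (T y)) \<le> orbit_dist x y" for n
    using orbit_dist_ge[OF assms, of "Suc n"] by (simp add: funpow_swap1)
  then show ?thesis
    using assms T_in_space by (simp add: orbit_dist_le_iff)
qed

lemma orbit_dist_measurable [measurable]:
  "(\<lambda>p. orbit_dist (fst p) (snd p)) \<in> borel_measurable (M \<Otimes>\<^sub>M M)"
proof -
  have d: "(\<lambda>p. d (fst p) (snd p)) \<in> borel_measurable (M \<Otimes>\<^sub>M M)"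
    using compatible by (simp add: compatible_metric_def case_prod_beta')
  have [measurable]: "(\<lambda>p. d ((T ^^ n) (fst p)) ((T ^^ n) (snd p))) \<in> borel_measurable (M \<Otimes>\<^sub>M M)" for n
  proof -
    have "(\<lambda>p. ((T ^^ n) (fst p), (T ^^ n) (snd p))) \<in> measurable (M \<Otimes>\<^sub>M M) (M \<Otimes>\<^sub>M M)"
      by measurable
    from measurable_compose[OF this d] show ?thesis
      by simp
  qed
  have "{p \<in> space (M \<Otimes>\<^sub>M M). orbit_dist (fst p) (snd p) \<le> r} =
      {p \<in> space (M \<Otimes>\<^sub>M M). \<forall>n. d ((T ^^ n) (fst p)) ((T ^^ n) (snd p)) \<le> r}" for r
    by (auto simp: space_pair_measure orbit_dist_le_iff)
  moreover have "{p \<in> space (M \<Otimes>\<^sub>M M). \<forall>n. d ((T ^^ n) (fst p)) ((T ^^ n) (snd p)) \<le> r}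
      \<in> sets (M \<Otimes>\<^sub>M M)" for r
    by measurable
  ultimately show ?thesis
    unfolding borel_measurable_iff_le by simp
qed

lemma orbit_dist_measurable1:
  assumes [measurable]: "f \<in> measurable N M" "g \<in> measurable N M"
  shows "(\<lambda>w. orbit_dist (f w) (g w)) \<in> borel_measurable N"
proof -
  have "(\<lambda>w. (f w, g w)) \<in> measurable N (M \<Otimes>\<^sub>M M)"
    by measurable
  from measurable_compose[OF this orbit_dist_measurable] show ?thesis
    by simp
qed

lemma ball_sets: "x \<in> space M \<Longrightarrow> o.mball x r \<in> sets M"
proof -
  assume x: "x \<in> space M"
  have [measurable]: "(\<lambda>y. orbit_dist x y) \<in> borel_measurable M"
    using x by (intro orbit_dist_measurable1) auto
  have "{y \<in> space M. orbit_dist x y < r} \<in> sets M"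
    by measurable
  moreover have "o.mball x r = {y \<in> space M. orbit_dist x y < r}"
    using x by auto
  ultimately show ?thesis
    by simp
qed

text \<open>Compatibility gives positive measure to the balls of \<open>d\<close> only. Balls of the
  orbit metric are smaller and may be null.\<close>

definition heavy :: "real \<Rightarrow> 'a set" where
  "heavy r = {x \<in> space M. emeasure M (o.mball x r) \<noteq> 0}"

text \<open>The balls are the sections of one measurable subset of the product, so their measure
  depends measurably on the centre.\<close>

lemma heavy_sets: "heavy r \<in> sets M"
proof -
  have [measurable]: "(\<lambda>p. orbit_dist (fst p) (snd p)) \<in> borel_measurable (M \<Otimes>\<^sub>M M)"
    by (rule orbit_dist_measurable)
  have "{p \<in> space (M \<Otimes>\<^sub>M M). orbit_dist (fst p) (snd p) < r} \<in> sets (M \<Otimes>\<^sub>M M)"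
    by measurable
  moreover have "{p \<in> space (M \<Otimes>\<^sub>M M). snd p \<in> o.mball (fst p) r} =
      {p \<in> space (M \<Otimes>\<^sub>M M). orbit_dist (fst p) (snd p) < r}"
    by (auto simp: space_pair_measure)
  ultimately have [measurable]: "(\<lambda>x. emeasure M (o.mball x r)) \<in> borel_measurable M"
    by (intro measurable_emeasure) auto
  show ?thesis
    unfolding heavy_def by measurable
qed

text \<open>A contraction maps the ball about \<open>x\<close> into the ball about
  \<open>T x\<close>. The latter therefore has a nonnull preimage, and nonsingularity makes it
  nonnull itself.\<close>

lemma heavy_invariant:
  assumes "x \<in> heavy r"
  shows "T x \<in> heavy r"
proof -
  have x: "x \<in> space M" "emeasure M (o.mball x r) \<noteq> 0"
    using assms by (auto simp: heavy_def)
  have "o.mball x r \<subseteq> T -` o.mball (T x) r \<inter> space M"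
    using orbit_dist_contraction T_in_space by force
  moreover have "T -` o.mball (T x) r \<inter> space M \<in> sets M"
    using x(1) T_in_space by (intro measurable_sets[OF measurable_map] ball_sets)
  ultimately have "emeasure M (T -` o.mball (T x) r \<inter> space M) \<noteq> 0"
    using x(2) emeasure_eq_0 by metis
  then show ?thesis
    using nonsingular[OF ball_sets[OF T_in_space[OF x(1)]]] T_in_space[OF x(1)]
    by (simp add: heavy_def)
qed

text \<open>If T^n x and T^n y are close for all n from N on, then T^N y lies in a small orbit ball
  \<open>D N\<close> about T^N x. Were every \<open>D N\<close> null, so would be all the preimages,
  and \<delta> would witness sensitivity at \<open>x\<close>. All points of a nonnull
  \<open>D N\<close> are heavy, as it has small diameter.\<close>

lemma heavy_nonnull:
  assumes "r > 0"
  shows "emeasure M (heavy r) \<noteq> 0"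
proof -
  \<comment> \<open>\<open>D N\<close> has radius 2\<delta> and so diameter at most 4\<delta>, which
    has to be less than \<open>r\<close>.\<close>
  define \<delta> where "\<delta> = r / 5"
  have "\<delta> > 0"
    using assms by (simp add: \<delta>_def)
  then obtain x where x: "x \<in> space M"
    "\<not> (AE y in M. limsup (\<lambda>n. ereal (d ((T ^^ n) x) ((T ^^ n) y))) > ereal \<delta>)"
    using insensitive unfolding W_measurably_sensitive_wrt_def by blast
  define D where "D N = {w \<in> space M. orbit_dist ((T ^^ N) x) w \<le> 2 * \<delta>}" for N
  have D: "D N \<in> sets M" for N
  proof -
    have [measurable]: "(\<lambda>w. orbit_dist ((T ^^ N) x) w) \<in> borel_measurable M"
      using pow_in_space[OF x(1)] by (intro orbit_dist_measurable1) auto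
    show ?thesis
      unfolding D_def by measurable
  qed
  have "\<exists>N. emeasure M (D N) \<noteq> 0"
  proof (rule ccontr)
    assume "\<not> ?thesis"
    then have "(T ^^ N) -` D N \<inter> space M \<in> null_sets M" for N
      using emeasure_pow_vimage_eq_0_iff[OF D] measurable_sets[OF pow_measurable D] by auto
    then have "AE y in M. \<forall>N. y \<notin> (T ^^ N) -` D N \<inter> space M"
      unfolding AE_all_countable by (intro allI AE_not_in)
    moreover have "limsup (\<lambda>n. ereal (d ((T ^^ n) x) ((T ^^ n) y))) > ereal \<delta>"
      if y: "y \<in> space M" and never: "\<forall>N. y \<notin> (T ^^ N) -` D N \<inter> space M" for y
    proof (rule ccontr)
      assume "\<not> ?thesis"
      \<comment> \<open>A limsup of at most \<delta> bounds the terms eventually only by something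
        larger, here 2\<delta>.\<close>
      moreover have "ereal \<delta> < ereal (2 * \<delta>)"
        using \<open>\<delta> > 0\<close> by simp
      ultimately have "limsup (\<lambda>n. ereal (d ((T ^^ n) x) ((T ^^ n) y))) < ereal (2 * \<delta>)"
        by (meson linorder_not_less order.strict_trans1)
      from Limsup_lessD[OF this] obtain N where
        N: "\<And>n. n \<ge> N \<Longrightarrow> d ((T ^^ n) x) ((T ^^ n) y) < 2 * \<delta>"
        by (auto simp: eventually_sequentially)
      have "d ((T ^^ n) ((T ^^ N) x)) ((T ^^ n) ((T ^^ N) y)) \<le> 2 * \<delta>" for n
        using N[of "n + N"] by (simp add: funpow_add)
      then have "(T ^^ N) y \<in> D N"
        using pow_in_space x(1) y by (simp add: D_def orbit_dist_le_iff)
      then show False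
        using never y by blast
    qed
    ultimately have "AE y in M. limsup (\<lambda>n. ereal (d ((T ^^ n) x) ((T ^^ n) y))) > ereal \<delta>"
      using AE_space by (auto elim: eventually_elim2)
    then show False
      using x(2) by contradiction
  qed
  then obtain N where N: "emeasure M (D N) \<noteq> 0"
    by blast
  have "D N \<subseteq> heavy r"
  proof
    fix w assume w: "w \<in> D N"
    let ?x = "(T ^^ N) x"
    have "D N \<subseteq> o.mball w r"
    proof
      fix v assume v: "v \<in> D N"
      have "orbit_dist w v \<le> orbit_dist w ?x + orbit_dist ?x v"
        using v w pow_in_space[OF x(1)] by (intro o.triangle) (auto simp: D_def)
      then have "orbit_dist w v \<le> 4 * \<delta>"
        using v w o.commute[of w ?x] by (auto simp: D_def)
      then show "v \<in> o.mball w r"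
        using v w assms by (simp add: D_def \<delta>_def)
    qed
    moreover have "w \<in> space M"
      using w by (simp add: D_def)
    ultimately show "w \<in> heavy r"
      using N emeasure_eq_0[OF ball_sets] unfolding heavy_def by blast
  qed
  then show ?thesis
    using N emeasure_eq_0[OF heavy_sets] by blast
qed

definition core :: "'a set" where
  "core = (\<Inter>m. heavy (inverse (Suc m)))"

lemma core_sets: "core \<in> sets M"
  unfolding core_def using heavy_sets by (intro sets.countable_INT') auto

lemma core_subset: "core \<subseteq> space M"
  by (rule sets.sets_into_space[OF core_sets])

lemma core_conull: "space M - core \<in> null_sets M"
proof -
  have "space M - heavy (inverse (Suc m)) \<in> null_sets M" for m
    using conull_of_forward_invariant[OF heavy_sets heavy_invariant heavy_nonnull] heavy_sets
    by (intro null_setsI) auto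
  then have "(\<Union>m. space M - heavy (inverse (Suc m))) \<in> null_sets M"
    by (intro null_sets_UN) auto
  moreover have "space M - core = (\<Union>m. space M - heavy (inverse (Suc m)))"
    by (auto simp: core_def)
  ultimately show ?thesis
    by simp
qed

lemma AE_core: "AE x in M. x \<in> core"
  using AE_not_in[OF core_conull] AE_space by eventually_elim auto

lemma core_invariant: "x \<in> core \<Longrightarrow> T x \<in> core"
  using heavy_invariant by (auto simp: core_def)

lemma core_ball:
  assumes x: "x \<in> core" and "r > 0"
  shows "emeasure M (o.mball x r) \<noteq> 0"
proof -
  obtain m where m: "inverse (Suc m) < r"
    using reals_Archimedean[OF \<open>r > 0\<close>] by auto
  have "x \<in> heavy (inverse (Suc m))"
    using x unfolding core_def by blast
  then have "emeasure M (o.mball x (inverse (Suc m))) \<noteq> 0"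
    by (simp add: heavy_def)
  moreover have "o.mball x (inverse (Suc m)) \<subseteq> o.mball x r"
    using m by auto
  ultimately show ?thesis
    using emeasure_eq_0[OF ball_sets] core_subset x by blast
qed

text \<open>
  Ergodicity makes almost every orbit visit a given ball infinitely often. Exchanging the
  quantifiers by Fubini yields one orbit that visits almost all balls, without knowing beforehand
  that the metric is separable.
\<close>

lemma ex_recurrent_point:
  "\<exists>z\<in>core. \<forall>x\<in>core. \<forall>r>0. \<forall>k. \<exists>n\<ge>k. orbit_dist x ((T ^^ n) z) < r"
proof -
  interpret MM: pair_sigma_finite M M ..
  \<comment> \<open>Only countable quantifiers occur, so that \<open>Q\<close> is measurable on the
    product and commutes with AE.\<close>
  define Q where "Q x z \<longleftrightarrow> (\<forall>m k. \<exists>n\<in>{k..}. orbit_dist x ((T ^^ n) z) < inverse (real (Suc m)))" for x z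
  have "AE z in M. Q x z" if x: "x \<in> core" for x
  proof -
    have "AE z in M. \<exists>n\<in>{k..}. orbit_dist x ((T ^^ n) z) < inverse (real (Suc m))" for m k :: nat
    proof -
      have "AE z in M. \<exists>n\<ge>k. (T ^^ n) z \<in> o.mball x (inverse (Suc m))"
        using x core_subset by (intro AE_visits_infinitely_often ball_sets core_ball) auto
      then show ?thesis
        by eventually_elim auto
    qed
    then show ?thesis
      unfolding Q_def AE_all_countable by blast
  qed
  then have "AE x in M. AE z in M. Q x z"
    using AE_core by (auto elim: eventually_mono)
  moreover have "{p \<in> space (M \<Otimes>\<^sub>M M). Q (fst p) (snd p)} \<in> sets (M \<Otimes>\<^sub>M M)"
  proof -
    have [measurable]: "(\<lambda>p. orbit_dist (fst p) ((T ^^ n) (snd p))) \<in> borel_measurable (M \<Otimes>\<^sub>M M)" for n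
      by (intro orbit_dist_measurable1) measurable
    show ?thesis
      unfolding Q_def by measurable
  qed
  ultimately have "AE z in M. AE x in M. Q x z"
    using MM.AE_commute by blast
  with AE_core have "AE z in M. z \<in> core \<and> (AE x in M. Q x z)"
    by eventually_elim auto
  then obtain z where z: "z \<in> core" "AE x in M. Q x z"
    using AE_imp_ex[OF _ nonzero] by blast
  have "\<exists>n\<ge>k. orbit_dist x ((T ^^ n) z) < r" if x: "x \<in> core" and "r > 0" for x r k
  proof -
    obtain m where m: "inverse (Suc m) < r / 2"
      using reals_Archimedean[of "r / 2"] \<open>r > 0\<close> by auto
    \<comment> \<open>Fubini controls almost every centre, not every one. The ball about
      \<open>x\<close> is not null, so it contains a good centre \<open>x'\<close>.\<close>
    have "\<exists>x'\<in>o.mball x (r / 2). Q x' z"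
    proof (rule ccontr)
      assume "\<not> ?thesis"
      then have "AE y in M. y \<notin> o.mball x (r / 2)"
        using z(2) by (auto elim: eventually_mono)
      then have "o.mball x (r / 2) \<in> null_sets M"
        using AE_iff_null_sets[OF ball_sets] x core_subset by blast
      then show False
        using core_ball[OF x, of "r / 2"] \<open>r > 0\<close> by auto
    qed
    then obtain x' where x': "x' \<in> o.mball x (r / 2)" "Q x' z"
      by blast
    then obtain n where n: "n \<ge> k" "orbit_dist x' ((T ^^ n) z) < inverse (real (Suc m))"
      unfolding Q_def by (meson atLeast_iff)
    have "(T ^^ n) z \<in> space M"
      using z core_subset pow_in_space by blast
    then have "orbit_dist x ((T ^^ n) z) \<le> orbit_dist x x' + orbit_dist x' ((T ^^ n) z)"
      using x' by (intro o.triangle) auto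
    then show ?thesis
      using x'(1) n m by (intro exI[of _ n]) auto
  qed
  then show ?thesis
    using z(1) by blast
qed

text \<open>An isolated point of the core would have positive measure, since its small balls are
  nonnull and the core is conull. A singleton has no subset of strictly intermediate measure,
  against nonatomicity.\<close>

lemma core_not_isolated:
  assumes x: "x \<in> core" and "r > 0"
  shows "\<exists>y\<in>core. y \<noteq> x \<and> orbit_dist x y < r"
proof (rule ccontr)
  assume "\<not> ?thesis"
  then have sub: "o.mball x r \<inter> core \<subseteq> {x}"
    by auto
  have A: "o.mball x r \<inter> core \<in> sets M"
    using ball_sets core_sets x core_subset by blast
  have "emeasure M (o.mball x r \<inter> core) = emeasure M (o.mball x r)"
  proof (rule emeasure_eq_AE)
    show "AE y in M. y \<in> o.mball x r \<inter> core \<longleftrightarrow> y \<in> o.mball x r"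
      using AE_core by eventually_elim auto
  qed (use A ball_sets x core_subset in auto)
  then have "emeasure M (o.mball x r \<inter> core) > 0"
    using core_ball[OF assms] by (simp add: zero_less_iff_neq_zero)
  then obtain B where B: "B \<subseteq> o.mball x r \<inter> core" "0 < emeasure M B"
    "emeasure M B < emeasure M (o.mball x r \<inter> core)"
    using nonatomic A unfolding nonatomic_def by blast
  then have "B \<noteq> {}" "B \<noteq> o.mball x r \<inter> core"
    by auto
  then show False
    using B(1) sub by blast
qed

lemma isomorphic_to_polish_isometry: "isomorphic_to_polish_isometry M T"
proof -
  obtain z where z: "z \<in> core"
    "\<And>x r k. x \<in> core \<Longrightarrow> r > 0 \<Longrightarrow> \<exists>n\<ge>k. orbit_dist x ((T ^^ n) z) < r"
    using ex_recurrent_point by blast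
  interpret Metric_space core orbit_dist
    by (rule o.subspace[OF core_subset])
  interpret R: recurrent_contraction core orbit_dist T z
  proof
    show "orbit_dist x y \<le> 1" if "x \<in> core" "y \<in> core" for x y
      using that core_subset pow_in_space d_le_1 by (auto simp: orbit_dist_le_iff subset_iff)
    show "orbit_dist (T x) (T y) \<le> orbit_dist x y" if "x \<in> core" "y \<in> core" for x y
      using that core_subset by (intro orbit_dist_contraction) auto
  qed (use z core_invariant core_not_isolated in auto)
  \<comment> \<open>This links the Borel structure of \<open>M\<close> to the topology of the
    completion; the dense orbit reduces it to countably many centres.\<close>
  have ball: "{x \<in> core. orbit_dist x ((T ^^ n) z) < r} \<in> sets M" for n r
  proof -
    have [measurable]: "(\<lambda>x. orbit_dist x ((T ^^ n) z)) \<in> borel_measurable M"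
      using z(1) core_subset pow_in_space by (intro orbit_dist_measurable1) auto
    have "core \<inter> {x \<in> space M. orbit_dist x ((T ^^ n) z) < r} \<in> sets M"
      using core_sets by measurable
    moreover have "core \<inter> {x \<in> space M. orbit_dist x ((T ^^ n) z) < r} =
        {x \<in> core. orbit_dist x ((T ^^ n) z) < r}"
      using core_subset by auto
    ultimately show ?thesis
      by simp
  qed
  obtain N where N: "space N = topspace R.C.mtopology" "sets N = borel_sets_of R.C.mtopology"
    "nonsingular_system N R.ext" "isomorphic_mod0 M T N R.ext"
  proof (rule isomorphic_mod0_embedding)
    show "completely_metrizable_space R.C.mtopology"
      by (rule R.C.completely_metrizable_space_mtopology[OF R.mcomplete_compl])
    show "separable_space R.C.mtopology"
      by (rule R.separable_compl)
    then show "second_countable R.C.mtopology"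
      by (rule R.C.separable_imp_second_countable)
    show "continuous_map R.C.mtopology R.C.mtopology R.ext"
      by (rule R.continuous_ext)
    show "emeasure M (space M - core) = 0"
      using core_conull by auto
    show "R.embed ` core \<subseteq> topspace R.C.mtopology"
      using R.embed_in by auto
    show "R.embed -` U \<inter> core \<in> sets M" if "openin R.C.mtopology U" for U
      by (rule R.embed_vimage_sets[OF ball that])
    show "R.embed (T x) = R.ext (R.embed x)" if "x \<in> core" for x
      using R.ext_embed[OF that] by simp
  qed (use core_sets R.inj_embed in auto)
  have "polish_isometry_system R.compl R.sup_dist R.ext N"
    unfolding polish_isometry_system_def
    using N R.C.Metric_space_axioms R.mcomplete_compl R.separable_compl R.bijective_isometry_ext
      R.minimal_ext R.uniformly_rigid_ext by simp
  then show ?thesis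
    unfolding isomorphic_to_polish_isometry_def using N(4) by blast
qed

end

theorem theorem1:
  fixes M :: "'a measure" and T :: "'a \<Rightarrow> 'a"
  assumes "nonsingular_system M T"
    and "conservative_ergodic M T"
  shows "W_measurably_sensitive M T \<or> isomorphic_to_polish_isometry M T"
proof (cases "W_measurably_sensitive M T")
  case False
  then obtain d where "compatible_metric M d" "\<not> W_measurably_sensitive_wrt M T d"
    unfolding W_measurably_sensitive_def by blast
  with assms interpret insensitive_metric M T d
    by (simp add: insensitive_metric_def insensitive_metric_axioms_def ergodic_system_def
        ergodic_system_axioms_def)
  show ?thesis
    using isomorphic_to_polish_isometry by blast
qed simp

end
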